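(* Let $X$ be a compact metric space with metric $d$, let $T\colon X\to X$ be a homeomorphism, let $\mu$ be a $T$-invariant Borel probability measure on $X$, and let $f\in L^2(X,\mu)$. Then the following statements are equivalent: (1) $f$ is an almost periodic function in $L^2(X,\mu)$. (2) $f$ is $\mu$-mean equicontinuous.
   Context: $f\in L^2(X,\mu)$ (complex-valued) is almost periodic if the closure of $\{f\circ T^n:n\in\mathbb{Z}\}$ is compact in $L^2(X,\mu)$. $f$ (regarded as an everywhere-defined measurable representative of its class) is $\mu$-mean equicontinuous if for any $\tau>0$ there is a compact subset $K\subset X$ with $\mu(K)>1-\tau$ such that for any $\epsilon>0$ there is $\delta>0$ such that whenever $x,y\in K$ with $d(x,y)<\delta$ we have $\limsup_{n\to\infty}\frac1n\sum_{i=0}^{n-1}|f(T^ix)-f(T^iy)|<\epsilon$. No ergodicity of $\mu$ is assumed. *)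

theory Defs
  imports "HOL-Probability.Probability"
begin

definition L2_fun :: "'a measure \<Rightarrow> ('a \<Rightarrow> complex) set" where
  "L2_fun M = {f \<in> borel_measurable M. integrable M (\<lambda>x. (cmod (f x))\<^sup>2)}"

definition L2_norm :: "'a measure \<Rightarrow> ('a \<Rightarrow> complex) \<Rightarrow> real" where
  "L2_norm M f = sqrt (\<integral>x. (cmod (f x))\<^sup>2 \<partial>M)"

definition AE_eq_rel :: "'a measure \<Rightarrow> ('a \<Rightarrow> complex) rel" where
  "AE_eq_rel M = {(f, g). f \<in> L2_fun M \<and> g \<in> L2_fun M \<and> (AE x in M. f x = g x)}"

definition L2_class :: "'a measure \<Rightarrow> ('a \<Rightarrow> complex) \<Rightarrow> ('a \<Rightarrow> complex) set" where
  "L2_class M f = AE_eq_rel M `` {f}"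

definition L2_space :: "'a measure \<Rightarrow> ('a \<Rightarrow> complex) set set" where
  "L2_space M = L2_fun M // AE_eq_rel M"

text \<open>The choice of representatives is immaterial, see \<open>L2_dist_class\<close> below. Outside
  \<open>L2_space M\<close> the value is irrelevant.\<close>

definition L2_dist ::
    "'a measure \<Rightarrow> ('a \<Rightarrow> complex) set \<Rightarrow> ('a \<Rightarrow> complex) set \<Rightarrow> real" where
  "L2_dist M F G = L2_norm M (\<lambda>x. (SOME f. f \<in> F) x - (SOME g. g \<in> G) x)"

definition L2_topology :: "'a measure \<Rightarrow> ('a \<Rightarrow> complex) set topology" where
  "L2_topology M = Metric_space.mtopology (L2_space M) (L2_dist M)"

text \<open>\<open>T\<^sup>n\<close> for an integer \<open>n\<close>; only meaningful for bijective \<open>T\<close>.\<close>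

definition int_iterate :: "('a \<Rightarrow> 'a) \<Rightarrow> int \<Rightarrow> 'a \<Rightarrow> 'a" where
  "int_iterate T n = (if 0 \<le> n then T ^^ nat n else inv T ^^ nat (- n))"

definition almost_periodic :: "'a measure \<Rightarrow> ('a \<Rightarrow> 'a) \<Rightarrow> ('a \<Rightarrow> complex) \<Rightarrow> bool" where
  "almost_periodic M T f \<longleftrightarrow>
     compactin (L2_topology M)
       (L2_topology M closure_of (range (\<lambda>n::int. L2_class M (f \<circ> int_iterate T n))))"

text \<open>The upper limit is taken in the extended reals, since the averages may be unbounded.\<close>

definition mean_equicontinuous ::
    "'a::metric_space measure \<Rightarrow> ('a \<Rightarrow> 'a) \<Rightarrow> ('a \<Rightarrow> complex) \<Rightarrow> bool" where
  "mean_equicontinuous M T f \<longleftrightarrow>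
     (\<forall>\<tau>>0. \<exists>K. compact K \<and> measure M K > 1 - \<tau> \<and>
        (\<forall>\<epsilon>>0. \<exists>\<delta>>0. \<forall>x\<in>K. \<forall>y\<in>K. dist x y < \<delta> \<longrightarrow>
           limsup (\<lambda>n. ereal ((1 / real n) * (\<Sum>i<n. cmod (f ((T ^^ i) x) - f ((T ^^ i) y)))))
             < ereal \<epsilon>))"

text \<open>\<open>L2_dist M\<close> is indeed a metric, so that \<open>L2_topology M\<close> is the norm topology.\<close>

lemma cmod_add_sq_le:
  assumes "0 < t" "t < 1"
  shows "(cmod (a + b))\<^sup>2 \<le> (cmod a)\<^sup>2 / t + (cmod b)\<^sup>2 / (1 - t)"
proof -
  define p q where "p = cmod a" and "q = cmod b"
  have "(cmod (a + b))\<^sup>2 \<le> (p + q)\<^sup>2"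
    unfolding p_def q_def by (intro power_mono norm_triangle_ineq) auto
  also have "(p + q)\<^sup>2 \<le> p\<^sup>2 / t + q\<^sup>2 / (1 - t)"
  proof -
    have "p\<^sup>2 / t + q\<^sup>2 / (1 - t) - (p + q)\<^sup>2 = ((1 - t) * p - t * q)\<^sup>2 / (t * (1 - t))"
      using assms by (simp add: divide_simps power2_eq_square) (simp add: algebra_simps)
    moreover have "\<dots> \<ge> 0"
      using assms by (intro divide_nonneg_pos) auto
    ultimately show ?thesis by linarith
  qed
  finally show ?thesis by (simp add: p_def q_def)
qed

lemma L2_fun_add:
  assumes "f \<in> L2_fun M" "g \<in> L2_fun M"
  shows "(\<lambda>x. f x + g x) \<in> L2_fun M"
proof -
  have [measurable]: "f \<in> borel_measurable M" "g \<in> borel_measurable M"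
    using assms by (auto simp: L2_fun_def)
  have "integrable M (\<lambda>x. (cmod (f x))\<^sup>2 / (1/2) + (cmod (g x))\<^sup>2 / (1 - 1/2))"
    using assms by (auto simp: L2_fun_def)
  then have "integrable M (\<lambda>x. (cmod (f x + g x))\<^sup>2)"
    by (rule Bochner_Integration.integrable_bound)
      (use cmod_add_sq_le[of "1/2"] in \<open>auto intro!: AE_I2\<close>)
  then show ?thesis by (simp add: L2_fun_def)
qed

lemma L2_fun_diff:
  assumes "f \<in> L2_fun M" "g \<in> L2_fun M"
  shows "(\<lambda>x. f x - g x) \<in> L2_fun M"
proof -
  have "(\<lambda>x. - g x) \<in> L2_fun M"
    using assms by (auto simp: L2_fun_def)
  from L2_fun_add[OF assms(1) this] show ?thesis by simp
qed

lemma L2_norm_nonneg: "0 \<le> L2_norm M f"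
  by (simp add: L2_norm_def)

lemma L2_norm_sq: "(L2_norm M f)\<^sup>2 = (\<integral>x. (cmod (f x))\<^sup>2 \<partial>M)"
  by (simp add: L2_norm_def)

lemma L2_norm_eq_0_iff:
  assumes "f \<in> L2_fun M"
  shows "L2_norm M f = 0 \<longleftrightarrow> (AE x in M. f x = 0)"
  using assms integral_nonneg_eq_0_iff_AE[of M "\<lambda>x. (cmod (f x))\<^sup>2"]
  by (auto simp: L2_norm_def L2_fun_def)

lemma L2_norm_cong_AE:
  assumes "f \<in> L2_fun M" "g \<in> L2_fun M" "AE x in M. f x = g x"
  shows "L2_norm M f = L2_norm M g"
proof -
  have "(\<integral>x. (cmod (f x))\<^sup>2 \<partial>M) = (\<integral>x. (cmod (g x))\<^sup>2 \<partial>M)"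
    using assms by (intro integral_cong_AE) (auto simp: L2_fun_def)
  then show ?thesis by (simp add: L2_norm_def)
qed

lemma L2_norm_triangle:
  assumes f: "f \<in> L2_fun M" and g: "g \<in> L2_fun M"
  shows "L2_norm M (\<lambda>x. f x + g x) \<le> L2_norm M f + L2_norm M g"
proof -
  define A B where "A = L2_norm M f" and "B = L2_norm M g"
  note fg = L2_fun_add[OF f g]
  consider "A = 0" | "B = 0" | "A > 0" "B > 0"
    using L2_norm_nonneg[of M f] L2_norm_nonneg[of M g] unfolding A_def B_def by linarith
  then show ?thesis
  proof cases
    case 1
    then have "AE x in M. f x = 0" using L2_norm_eq_0_iff[OF f] by (simp add: A_def)
    then have "L2_norm M (\<lambda>x. f x + g x) = L2_norm M g"
      by (intro L2_norm_cong_AE fg g) auto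
    then show ?thesis using L2_norm_nonneg[of M f] by simp
  next
    case 2
    then have "AE x in M. g x = 0" using L2_norm_eq_0_iff[OF g] by (simp add: B_def)
    then have "L2_norm M (\<lambda>x. f x + g x) = L2_norm M f"
      by (intro L2_norm_cong_AE fg f) auto
    then show ?thesis using L2_norm_nonneg[of M g] by simp
  next
    case 3
    define t where "t = A / (A + B)"
    have t: "0 < t" "t < 1" and t': "1 - t = B / (A + B)"
      using 3 by (auto simp: t_def field_simps)
    have "(L2_norm M (\<lambda>x. f x + g x))\<^sup>2 \<le> (\<integral>x. (cmod (f x))\<^sup>2 / t + (cmod (g x))\<^sup>2 / (1 - t) \<partial>M)"
      unfolding L2_norm_sq using f g fg cmod_add_sq_le[OF t]
      by (intro integral_mono) (auto simp: L2_fun_def)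
    also have "\<dots> = A\<^sup>2 / t + B\<^sup>2 / (1 - t)"
      using f g by (simp add: A_def B_def L2_norm_sq L2_fun_def)
    also have "\<dots> = (A + B)\<^sup>2"
      unfolding t' unfolding t_def using 3 by (simp add: power2_eq_square field_simps)
    finally have "L2_norm M (\<lambda>x. f x + g x) \<le> A + B"
      by (rule power2_le_imp_le) (use 3 in linarith)
    then show ?thesis by (simp only: A_def B_def)
  qed
qed

lemma equiv_AE_eq_rel: "equiv (L2_fun M) (AE_eq_rel M)"
proof (rule equivI)
  show "AE_eq_rel M \<subseteq> L2_fun M \<times> L2_fun M" "refl_on (L2_fun M) (AE_eq_rel M)"
    by (auto simp: refl_on_def AE_eq_rel_def)
  show "sym (AE_eq_rel M)"
    by (auto simp: sym_def AE_eq_rel_def eq_commute)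
  show "trans (AE_eq_rel M)"
  proof (rule transI)
    fix f g h assume *: "(f, g) \<in> AE_eq_rel M" "(g, h) \<in> AE_eq_rel M"
    then have "AE x in M. f x = g x" "AE x in M. g x = h x"
      by (auto simp: AE_eq_rel_def)
    then have "AE x in M. f x = h x" by eventually_elim simp
    with * show "(f, h) \<in> AE_eq_rel M" by (simp add: AE_eq_rel_def)
  qed
qed

lemma L2_spaceE:
  assumes "F \<in> L2_space M"
  obtains f where "f \<in> L2_fun M" "F = L2_class M f"
  using assms by (auto simp: L2_space_def L2_class_def elim: quotientE)

lemma L2_class_eq_iff:
  assumes "f \<in> L2_fun M" "g \<in> L2_fun M"
  shows "L2_class M f = L2_class M g \<longleftrightarrow> (AE x in M. f x = g x)"
  using eq_equiv_class_iff[OF equiv_AE_eq_rel assms] assms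
  by (simp add: L2_class_def AE_eq_rel_def)

lemma L2_dist_class:
  assumes f: "f \<in> L2_fun M" and g: "g \<in> L2_fun M"
  shows "L2_dist M (L2_class M f) (L2_class M g) = L2_norm M (\<lambda>x. f x - g x)"
proof -
  define f' where "f' = (SOME h. h \<in> L2_class M f)"
  define g' where "g' = (SOME h. h \<in> L2_class M g)"
  have "f' \<in> L2_class M f" unfolding f'_def
    by (rule someI[of _ f]) (use f in \<open>auto simp: L2_class_def AE_eq_rel_def\<close>)
  then have f': "f' \<in> L2_fun M" "AE x in M. f x = f' x"
    by (auto simp: L2_class_def AE_eq_rel_def)
  have "g' \<in> L2_class M g" unfolding g'_def
    by (rule someI[of _ g]) (use g in \<open>auto simp: L2_class_def AE_eq_rel_def\<close>)
  then have g': "g' \<in> L2_fun M" "AE x in M. g x = g' x"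
    by (auto simp: L2_class_def AE_eq_rel_def)
  have "L2_norm M (\<lambda>x. f' x - g' x) = L2_norm M (\<lambda>x. f x - g x)"
    by (rule L2_norm_cong_AE[OF L2_fun_diff[OF f'(1) g'(1)] L2_fun_diff[OF f g]])
      (use f'(2) g'(2) in eventually_elim, simp)
  then show ?thesis by (simp add: L2_dist_def f'_def g'_def)
qed

lemma Metric_space_L2: "Metric_space (L2_space M) (L2_dist M)"
proof
  show "0 \<le> L2_dist M F G" for F G
    by (simp add: L2_dist_def L2_norm_nonneg)
  show "L2_dist M F G = L2_dist M G F" for F G
    by (simp add: L2_dist_def L2_norm_def norm_minus_commute)
  show "L2_dist M F G = 0 \<longleftrightarrow> F = G" if FG: "F \<in> L2_space M" "G \<in> L2_space M" for F G
  proof -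
    obtain f where "f \<in> L2_fun M" "F = L2_class M f"
      by (rule L2_spaceE[OF FG(1)])
    moreover obtain g where "g \<in> L2_fun M" "G = L2_class M g"
      by (rule L2_spaceE[OF FG(2)])
    ultimately show ?thesis
      by (simp add: L2_dist_class L2_class_eq_iff L2_norm_eq_0_iff[OF L2_fun_diff])
  qed
  show "L2_dist M F H \<le> L2_dist M F G + L2_dist M G H"
    if FGH: "F \<in> L2_space M" "G \<in> L2_space M" "H \<in> L2_space M" for F G H
  proof -
    obtain f where f: "f \<in> L2_fun M" "F = L2_class M f"
      by (rule L2_spaceE[OF FGH(1)])
    obtain g where g: "g \<in> L2_fun M" "G = L2_class M g"
      by (rule L2_spaceE[OF FGH(2)])
    obtain h where h: "h \<in> L2_fun M" "H = L2_class M h"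
      by (rule L2_spaceE[OF FGH(3)])
    show ?thesis
      using L2_norm_triangle[OF L2_fun_diff[OF f(1) g(1)] L2_fun_diff[OF g(1) h(1)]]
      by (simp add: f g h L2_dist_class)
  qed
qed

end

theory Submission
  imports Defs
begin

text \<open>
  Write \<open>D(x, y)\<close> for the upper limit of the averages of \<open>\<bar>f(T^i x) - f(T^i y)\<bar>\<close>. By Birkhoff's theorem on
  \<open>M \<Otimes> M\<close> these averages converge to \<open>D\<close> almost everywhere and in \<open>L\<^sup>1\<close>, so for every cell \<open>P\<close> the
  averages over \<open>i\<close> of the mean oscillation of \<open>f \<circ> T^i\<close> on \<open>P \<times> P\<close> converge to the mean of \<open>D\<close> on \<open>P \<times> P\<close>.
  Mean equicontinuity says that, up to small measure, the space is covered by finitely many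
  \<open>D\<close>-small sets; almost periodicity says that the orbit is totally bounded, in \<open>L\<^sup>2\<close> or equivalently
  (the orbit being identically distributed) in \<open>L\<^sup>1\<close>. If the orbit is totally bounded, then all \<open>f \<circ> T^i\<close>
  have small oscillation on the cells of one finite partition, hence \<open>D\<close> is small there. Conversely,
  if \<open>D\<close> is small on the cells of a finite partition, then for most \<open>i\<close> the function \<open>f \<circ> T^i\<close> is
  close to one of finitely many simple functions, and differences of such \<open>i\<close> exhaust the integers.
\<close>

section \<open>The maximal and the pointwise ergodic theorem\<close>

text \<open>Two obstacles shape the argument. First, Birkhoff's theorem controls \<open>D\<close>
  only almost everywhere on the product, while mean equicontinuity speaks of every pair of points of
  a compact set. Hence \<open>D\<close> is kept as an everywhere defined upper limit, for which the
  triangle inequality holds at all points, and smallness almost everywhere on a square becomes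
  smallness for all pairs by comparison with one centre. Without ergodicity \<open>D\<close> is a
  genuine function and not a constant, so it is used through its means over squares. Second, the
  averages run over nonnegative times and say nothing about an individual time. Invariance repairs
  this: the distance of \<open>f \<circ> T^m\<close> and \<open>f \<circ> T^n\<close> depends only
  on \<open>m - n\<close>, and a set of times that misses at most an eighth of every long initial
  segment meets each of its translates. The estimates live in L1 because mean equicontinuity
  averages differences without squaring them.\<close>

text \<open>\<open>max_sum S h n\<close> is the maximum of the Birkhoff sums of \<open>h\<close> of lengths \<open>1, \<dots>, n + 1\<close>.\<close>

primrec max_sum :: "('a \<Rightarrow> 'a) \<Rightarrow> ('a \<Rightarrow> real) \<Rightarrow> nat \<Rightarrow> 'a \<Rightarrow> real" where
  "max_sum S h 0 z = h z"
| "max_sum S h (Suc n) z = h z + max 0 (max_sum S h n (S z))"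

lemma max_sum_mono: "max_sum S h n z \<le> max_sum S h (Suc n) z"
proof (induction n arbitrary: z)
  case (Suc n)
  have "max 0 (max_sum S h n (S z)) \<le> max 0 (max_sum S h (Suc n) (S z))"
    by (intro max.mono Suc.IH order_refl)
  then show ?case by simp
qed simp

lemma sum_le_max_sum: "(\<Sum>i<Suc k. h ((S ^^ i) z)) \<le> max_sum S h k z"
proof (induction k arbitrary: z)
  case (Suc k)
  have "(\<Sum>i<Suc (Suc k). h ((S ^^ i) z)) = h z + (\<Sum>i<Suc k. h ((S ^^ i) (S z)))"
    by (subst sum.lessThan_Suc_shift) (simp add: funpow_swap1 del: sum.lessThan_Suc)
  also have "\<dots> \<le> max_sum S h (Suc k) z"
    using Suc.IH[of "S z"] by simp
  finally show ?case .
qed simp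

locale measure_preserving =
  fixes N :: "'a measure" and S :: "'a \<Rightarrow> 'a"
  assumes prob_N: "prob_space N"
    and meas_S [measurable]: "S \<in> measurable N N"
    and distr_S: "distr N N S = N"
begin

sublocale prob_space N by (rule prob_N)

lemma meas_iter [measurable]: "S ^^ i \<in> measurable N N"
  by (induction i) (auto intro: measurable_comp)

lemma distr_iter: "distr N N (S ^^ i) = N"
proof (induction i)
  case 0 then show ?case by (simp add: id_def)
next
  case (Suc i)
  have "distr N N (S ^^ Suc i) = distr (distr N N (S ^^ i)) N S"
    by (simp add: distr_distr)
  then show ?case by (simp add: Suc distr_S comp_def)
qed

lemma integrable_iter:
  fixes h :: "'a \<Rightarrow> 'b::{banach, second_countable_topology}"
  assumes "integrable N h"
  shows "integrable N (\<lambda>z. h ((S ^^ i) z))"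
  by (rule integrable_distr[OF meas_iter]) (simp add: distr_iter assms)

lemma integral_iter:
  fixes h :: "'a \<Rightarrow> 'b::{banach, second_countable_topology}"
  assumes [measurable]: "h \<in> borel_measurable N"
  shows "(\<integral>z. h ((S ^^ i) z) \<partial>N) = (\<integral>z. h z \<partial>N)"
  using integral_distr[OF meas_iter assms, of i] by (simp add: distr_iter)

lemma integrable_max_sum:
  assumes "integrable N h"
  shows "integrable N (max_sum S h n)"
proof (induction n)
  case 0 then show ?case using assms by (simp add: fun_eq_iff[symmetric] cong: integrable_cong)
next
  case (Suc n)
  from integrable_iter[OF Suc, of 1] have "integrable N (\<lambda>z. max_sum S h n (S z))" by simp
  then show ?case using assms by simp
qed

text \<open>Garsia's argument. With M_n for \<open>max_sum S h n\<close>, the recursion and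
  monotonicity in \<open>n\<close> give M_n \<le> h + max 0 (M_n \<circ> S). Integrating this and
  using invariance leaves the integral of min 0 M_n below that of \<open>h\<close>. By hypothesis
  M_n is eventually nonnegative almost everywhere, so these minima tend to 0; they are dominated by
  the absolute value of \<open>h\<close> because M_n \<ge> M_0 = h.\<close>

lemma maximal_ergodic:
  fixes h :: "'a \<Rightarrow> real"
  assumes int: "integrable N h"
    and ex: "AE z in N. \<exists>k\<ge>1. 0 \<le> (\<Sum>i<k. h ((S ^^ i) z))"
  shows "0 \<le> (\<integral>z. h z \<partial>N)"
proof -
  let ?M = "max_sum S h"
  note [simp] = integrable_max_sum[OF int]
  have [measurable]: "?M n \<in> borel_measurable N" for n
    by (rule borel_measurable_integrable) simp
  have mono: "m \<le> n \<Longrightarrow> ?M m z \<le> ?M n z" for m n z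
    by (rule lift_Suc_mono_le[of "\<lambda>n. ?M n z"]) (rule max_sum_mono)
  have le: "(\<integral>z. min 0 (?M n z) \<partial>N) \<le> (\<integral>z. h z \<partial>N)" for n
  proof -
    from integrable_iter[OF integrable_max_sum[OF int], of n 1]
    have i: "integrable N (\<lambda>z. ?M n (S z))" by simp
    have "(\<integral>z. ?M n z \<partial>N) \<le> (\<integral>z. ?M (Suc n) z \<partial>N)"
      by (intro integral_mono max_sum_mono integrable_max_sum int)
    also have "\<dots> = (\<integral>z. h z \<partial>N) + (\<integral>z. max 0 (?M n (S z)) \<partial>N)"
      using int i by simp
    also have "(\<integral>z. max 0 (?M n (S z)) \<partial>N) = (\<integral>z. max 0 (?M n z) \<partial>N)"
      using integral_iter[of "\<lambda>z. max 0 (?M n z)" 1] by simp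
    finally have "(\<integral>z. ?M n z - max 0 (?M n z) \<partial>N) \<le> (\<integral>z. h z \<partial>N)"
      by (subst Bochner_Integration.integral_diff) auto
    moreover have "?M n z - max 0 (?M n z) = min 0 (?M n z)" for z by (simp add: min_def max_def)
    ultimately show ?thesis by simp
  qed
  have "(\<lambda>n. \<integral>z. min 0 (?M n z) \<partial>N) \<longlonglongrightarrow> (\<integral>z. 0 \<partial>N)"
  proof (rule integral_dominated_convergence)
    show "integrable N (\<lambda>z. \<bar>h z\<bar>)" using int by simp
    show "AE z in N. (\<lambda>n. min 0 (?M n z)) \<longlonglongrightarrow> 0"
      using ex
    proof eventually_elim
      case (elim z)
      then obtain k where k: "k \<ge> 1" "0 \<le> (\<Sum>i<k. h ((S ^^ i) z))" by auto
      then obtain j where "k = Suc j" by (cases k) auto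
      with k sum_le_max_sum[of h S z j] have "0 \<le> ?M j z" by simp
      then have "0 \<le> ?M n z" if "j \<le> n" for n using mono[OF that, of z] by linarith
      then have "eventually (\<lambda>n. min 0 (?M n z) = 0) sequentially"
        by (intro eventually_sequentiallyI[of j]) auto
      then show ?case by (rule tendsto_eventually)
    qed
    show "AE z in N. norm (min 0 (?M n z)) \<le> \<bar>h z\<bar>" for n
    proof (rule AE_I2)
      show "norm (min 0 (?M n z)) \<le> \<bar>h z\<bar>" for z
        using mono[of 0 n z] by (auto simp: min_def)
    qed
  qed auto
  from LIMSEQ_le_const2[OF this] le show ?thesis by auto
qed


section \<open>Birkhoff averages and their limits\<close>

definition avg :: "('a \<Rightarrow> real) \<Rightarrow> nat \<Rightarrow> 'a \<Rightarrow> real" where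
  "avg F n z = (1 / real n) * (\<Sum>i<n. F ((S ^^ i) z))"

lemma integrable_avg: "integrable N F \<Longrightarrow> integrable N (avg F n)"
  unfolding avg_def by (intro integrable_mult_right Bochner_Integration.integrable_sum integrable_iter)

lemma avg_nonneg: "(\<And>z. 0 \<le> F z) \<Longrightarrow> 0 \<le> avg F n z"
  unfolding avg_def by (intro mult_nonneg_nonneg sum_nonneg) auto

lemma sum_eq_avg: "(\<Sum>i<n. F ((S ^^ i) z)) = real n * avg F n z"
  by (simp add: avg_def)

lemma integral_avg: "integrable N F \<Longrightarrow> n \<ge> 1 \<Longrightarrow> (\<integral>z. avg F n z \<partial>N) = (\<integral>z. F z \<partial>N)"
  unfolding avg_def by (simp add: Bochner_Integration.integral_sum integrable_iter integral_iter)

lemma avg_step: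
  assumes "n \<ge> 1"
  shows "avg F n (S z) = - F z / real n + (1 + 1 / real n) * avg F (n + 1) z"
proof -
  have "(\<Sum>i<n+1. F ((S ^^ i) z)) = F z + (\<Sum>i<n. F ((S ^^ i) (S z)))"
    by (simp only: Suc_eq_plus1[symmetric], subst sum.lessThan_Suc_shift)
      (simp add: funpow_swap1 del: sum.lessThan_Suc)
  moreover have "(1 + 1 / real n) * (1 / real (n + 1)) = 1 / real n"
    using assms by (simp add: field_simps)
  ultimately show ?thesis
    unfolding avg_def mult.assoc[symmetric] by (simp add: ring_distribs)
qed

text \<open>By \<open>avg_step\<close>, moving the starting point shifts the index by one,
  multiplies by a factor tending to 1 and adds a null sequence. The computation takes place in the
  extended reals because finiteness of the limits is only established later.\<close>

lemma
  shows limsup_avg_invariant: "limsup (\<lambda>n. ereal (avg F n (S z))) = limsup (\<lambda>n. ereal (avg F n z))"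
    and liminf_avg_invariant: "liminf (\<lambda>n. ereal (avg F n (S z))) = liminf (\<lambda>n. ereal (avg F n z))"
proof -
  have ev: "eventually (\<lambda>n. ereal (avg F n (S z)) =
      ereal (- F z / real n) + ereal (1 + 1 / real n) * ereal (avg F (n + 1) z)) sequentially"
    using eventually_ge_at_top[of 1] by eventually_elim (simp add: avg_step)
  have "(\<lambda>n. - F z / real n) \<longlonglongrightarrow> 0" by (rule lim_const_over_n)
  then have a: "(\<lambda>n. ereal (- F z / real n)) \<longlonglongrightarrow> ereal 0" by (rule tendsto_ereal)
  have "(\<lambda>n. 1 + 1 / real n) \<longlonglongrightarrow> 1"
    using tendsto_add[OF tendsto_const lim_const_over_n[of 1], of 1] by simp
  then have b: "(\<lambda>n. ereal (1 + 1 / real n)) \<longlonglongrightarrow> ereal 1" by (rule tendsto_ereal)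
  have fin: "\<bar>ereal 0\<bar> \<noteq> \<infinity>" "ereal 1 > 0" "ereal 1 \<noteq> \<infinity>" by simp_all
  note m = ereal_limsup_lim_mult[OF b fin(2,3)] ereal_liminf_lim_mult[OF b fin(2,3)]
  note p = ereal_limsup_lim_add[OF a fin(1)] ereal_liminf_lim_add[OF a fin(1)]
  show "limsup (\<lambda>n. ereal (avg F n (S z))) = limsup (\<lambda>n. ereal (avg F n z))"
    unfolding Limsup_eq[OF ev]
    unfolding p(1) m(1) limsup_shift[of "\<lambda>n. ereal (avg F n z)"]
    by (simp add: zero_ereal_def[symmetric] one_ereal_def[symmetric])
  show "liminf (\<lambda>n. ereal (avg F n (S z))) = liminf (\<lambda>n. ereal (avg F n z))"
    unfolding Liminf_eq[OF ev]
    unfolding p(2) m(2) liminf_shift[of "\<lambda>n. ereal (avg F n z)"]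
    by (simp add: zero_ereal_def[symmetric] one_ereal_def[symmetric])
qed

lemma
  shows limsup_avg_iter: "limsup (\<lambda>n. ereal (avg F n ((S ^^ i) z))) = limsup (\<lambda>n. ereal (avg F n z))"
    and liminf_avg_iter: "liminf (\<lambda>n. ereal (avg F n ((S ^^ i) z))) = liminf (\<lambda>n. ereal (avg F n z))"
  by (induction i) (simp_all add: limsup_avg_invariant liminf_avg_invariant)

text \<open>The upper and lower limits \<open>L\<close>, \<open>l\<close> of the averages are invariant, so the maximal ergodic theorem
  applies to \<open>F - min L n + e\<close> and \<open>l - F + e\<close> and yields \<open>\<integral>L \<le> \<integral>F \<le> \<integral>l\<close>.\<close>

theorem birkhoff:
  assumes int: "integrable N F" and nonneg: "\<And>z. 0 \<le> F z"
  obtains g where "integrable N g" "\<And>z. 0 \<le> g z" "AE z in N. (\<lambda>n. avg F n z) \<longlonglongrightarrow> g z"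
    "(\<lambda>n. \<integral>z. \<bar>avg F n z - g z\<bar> \<partial>N) \<longlonglongrightarrow> 0"
proof -
  have [measurable]: "F \<in> borel_measurable N" using int by simp
  have [measurable]: "avg F n \<in> borel_measurable N" for n using integrable_avg[OF int] by auto
  define L where "L z = limsup (\<lambda>n. ereal (avg F n z))" for z
  define l where "l z = liminf (\<lambda>n. ereal (avg F n z))" for z
  have [measurable]: "L \<in> borel_measurable N" "l \<in> borel_measurable N"
    unfolding L_def l_def by measurable
  have l_le_L: "l z \<le> L z" for z unfolding l_def L_def by (intro Liminf_le_Limsup) auto
  have l_nonneg: "0 \<le> l z" for z
    unfolding l_def by (intro Liminf_bounded always_eventually) (simp add: avg_nonneg nonneg)
  have L_nonneg: "0 \<le> L z" for z using l_nonneg l_le_L order_trans by blast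
  have inv: "L ((S ^^ i) z) = L z" "l ((S ^^ i) z) = l z" for i z
    by (simp_all add: L_def l_def limsup_avg_iter liminf_avg_iter)

  \<comment> \<open>At this stage \<open>L\<close> may be infinite. The maximal theorem is therefore
    applied to bounded truncations, which inherit the invariance of \<open>L\<close>; monotone
    convergence then recovers \<open>L\<close>.\<close>
  define c where "c n z = real_of_ereal (min (L z) (ereal (real n)))" for n :: nat and z
  have c_ereal: "ereal (c n z) = min (L z) (ereal (real n))" for n z
    using L_nonneg[of z] unfolding c_def by (cases "L z") (auto simp: min_def)
  have c_bounds: "0 \<le> c n z" "c n z \<le> real n" for n z
  proof -
    have "ereal 0 \<le> ereal (c n z)"
      unfolding c_ereal using L_nonneg[of z] by (simp add: zero_ereal_def[symmetric])
    then show "0 \<le> c n z" by simp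
    have "ereal (c n z) \<le> ereal (real n)" unfolding c_ereal by simp
    then show "c n z \<le> real n" by simp
  qed
  have [measurable]: "c n \<in> borel_measurable N" for n unfolding c_def by measurable
  have c_int: "integrable N (c n)" for n
    by (rule integrable_const_bound[of _ "real n"]) (use c_bounds in auto)
  have c_le: "(\<integral>z. c n z \<partial>N) \<le> (\<integral>z. F z \<partial>N)" for n
  proof (rule field_le_epsilon)
    fix e :: real assume e: "e > 0"
    have "0 \<le> (\<integral>z. F z - c n z + e \<partial>N)"
    proof (rule maximal_ergodic)
      show "AE z in N. \<exists>k\<ge>1. 0 \<le> (\<Sum>i<k. F ((S ^^ i) z) - c n ((S ^^ i) z) + e)"
      proof (rule AE_I2)
        fix z
        \<comment> \<open>The slack \<open>e\<close> matters: an upper limit need not be reached by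
          any single average.\<close>
        have "\<exists>k\<ge>1. c n z - e \<le> avg F k z"
        proof (rule ccontr)
          assume "\<not> ?thesis"
          then have "avg F k z \<le> c n z - e" if "k \<ge> 1" for k using that by force
          then have "eventually (\<lambda>k. ereal (avg F k z) \<le> ereal (c n z - e)) sequentially"
            by (intro eventually_sequentiallyI[of 1]) auto
          then have "L z \<le> ereal (c n z - e)" unfolding L_def by (rule Limsup_bounded)
          moreover have "ereal (c n z) \<le> L z" by (simp add: c_ereal)
          ultimately have "ereal (c n z) \<le> ereal (c n z - e)" by (rule order_trans[rotated])
          with e show False by simp
        qed
        then obtain k where k: "k \<ge> 1" "c n z - e \<le> avg F k z" by auto
        have "c n ((S ^^ i) z) = c n z" for i by (simp add: c_def inv)
        then have "(\<Sum>i<k. F ((S ^^ i) z) - c n ((S ^^ i) z) + e) = real k * (avg F k z - c n z + e)"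
          by (simp add: sum.distrib sum_subtractf sum_eq_avg algebra_simps)
        with k show "\<exists>k\<ge>1. 0 \<le> (\<Sum>i<k. F ((S ^^ i) z) - c n ((S ^^ i) z) + e)" by auto
      qed
    qed (use int c_int in auto)
    also have "(\<integral>z. F z - c n z + e \<partial>N) = (\<integral>z. F z \<partial>N) - (\<integral>z. c n z \<partial>N) + e"
      using int c_int by (simp add: prob_space)
    finally show "(\<integral>z. c n z \<partial>N) \<le> (\<integral>z. F z \<partial>N) + e" by simp
  qed

  have "(\<integral>\<^sup>+z. e2ennreal (L z) \<partial>N) \<le> (\<integral>\<^sup>+z. (SUP n. ennreal (c n z)) \<partial>N)"
  proof (rule nn_integral_mono)
    fix z
    show "e2ennreal (L z) \<le> (SUP n. ennreal (c n z))"
    proof (cases "L z")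
      case (real r)
      obtain n where "r \<le> real n" using real_arch_simple by blast
      with real have "c n z = r" unfolding c_def by (simp add: min_def)
      then show ?thesis using real by (intro SUP_upper2[of n]) auto
    next
      case PInf
      then have "c n z = real n" for n by (simp add: c_def min_def)
      then have "(SUP n. ennreal (c n z)) = \<top>"
        by (simp only: ennreal_of_nat_eq_real_of_nat[symmetric] ennreal_SUP_of_nat_eq_top)
      then show ?thesis by (simp only: top_greatest)
    qed (use L_nonneg[of z] in auto)
  qed
  also have "\<dots> = (SUP n. \<integral>\<^sup>+z. ennreal (c n z) \<partial>N)"
  proof (rule nn_integral_monotone_convergence_SUP)
    show "incseq (\<lambda>n z. ennreal (c n z))"
    proof (intro incseq_SucI le_funI ennreal_leI)
      fix n z
      have "ereal (c n z) \<le> ereal (c (Suc n) z)"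
        unfolding c_ereal by (intro min.mono) auto
      then show "c n z \<le> c (Suc n) z" by simp
    qed
  qed measurable
  also have "\<dots> \<le> ennreal (\<integral>z. F z \<partial>N)"
    by (intro SUP_least) (use c_le c_bounds c_int in \<open>simp add: nn_integral_eq_integral ennreal_leI\<close>)
  finally have Lint: "(\<integral>\<^sup>+z. e2ennreal (L z) \<partial>N) \<le> ennreal (\<integral>z. F z \<partial>N)" .
  then have "(\<integral>\<^sup>+z. e2ennreal (L z) \<partial>N) \<noteq> \<infinity>"
    by (metis ennreal_neq_top infinity_ennreal_def top.extremum_uniqueI)
  from nn_integral_PInf_AE[OF _ this] have "AE z in N. e2ennreal (L z) \<noteq> \<infinity>" by simp
  then have L_fin: "AE z in N. L z < \<infinity>"
    by eventually_elim (auto simp: less_top[symmetric] e2ennreal_infty)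

  \<comment> \<open>On the null set where \<open>L\<close> is infinite \<open>real_of_ereal\<close>
    yields 0, so \<open>g\<close> is nonnegative everywhere and not just almost everywhere.\<close>
  define g where "g z = real_of_ereal (L z)" for z
  define d where "d z = real_of_ereal (l z)" for z
  have [measurable]: "g \<in> borel_measurable N" "d \<in> borel_measurable N"
    unfolding g_def d_def by measurable
  have g_nonneg: "0 \<le> g z" for z unfolding g_def by (simp add: L_nonneg real_of_ereal_pos)
  have gd: "AE z in N. L z = ereal (g z) \<and> l z = ereal (d z) \<and> d z \<le> g z \<and> 0 \<le> d z"
    using L_fin
  proof eventually_elim
    case (elim z)
    with L_nonneg[of z] l_nonneg[of z] l_le_L[of z] show ?case
      unfolding g_def d_def by (cases "L z"; cases "l z") auto
  qed
  have nn_g: "(\<integral>\<^sup>+z. ennreal (g z) \<partial>N) \<le> ennreal (\<integral>z. F z \<partial>N)"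
  proof -
    have "(\<integral>\<^sup>+z. ennreal (g z) \<partial>N) = (\<integral>\<^sup>+z. e2ennreal (L z) \<partial>N)"
      by (rule nn_integral_cong_AE) (use gd in eventually_elim, auto)
    with Lint show ?thesis by simp
  qed
  have g_int: "integrable N g"
    by (rule integrableI_nonneg) (use nn_g g_nonneg in \<open>auto simp: less_top[symmetric] top_unique\<close>)
  have g_le: "(\<integral>z. g z \<partial>N) \<le> (\<integral>z. F z \<partial>N)"
    using nn_g g_int g_nonneg nonneg by (simp add: nn_integral_eq_integral)
  have d_int: "integrable N d"
    by (rule Bochner_Integration.integrable_bound[OF g_int]) (use gd in \<open>auto elim: AE_mp\<close>)
  have d_ge: "(\<integral>z. F z \<partial>N) \<le> (\<integral>z. d z \<partial>N)"
  proof (rule field_le_epsilon)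
    fix e :: real assume e: "e > 0"
    have "0 \<le> (\<integral>z. d z - F z + e \<partial>N)"
    proof (rule maximal_ergodic)
      show "AE z in N. \<exists>k\<ge>1. 0 \<le> (\<Sum>i<k. d ((S ^^ i) z) - F ((S ^^ i) z) + e)"
        using gd
      proof eventually_elim
        case (elim z)
        have "\<exists>k\<ge>1. avg F k z \<le> d z + e"
        proof (rule ccontr)
          assume "\<not> ?thesis"
          then have "d z + e \<le> avg F k z" if "k \<ge> 1" for k using that by force
          then have "eventually (\<lambda>k. ereal (d z + e) \<le> ereal (avg F k z)) sequentially"
            by (intro eventually_sequentiallyI[of 1]) auto
          then have "ereal (d z + e) \<le> l z" unfolding l_def by (rule Liminf_bounded)
          with elim e show False by simp
        qed
        then obtain k where k: "k \<ge> 1" "avg F k z \<le> d z + e" by auto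
        have "d ((S ^^ i) z) = d z" for i by (simp add: d_def inv)
        then have "(\<Sum>i<k. d ((S ^^ i) z) - F ((S ^^ i) z) + e) = real k * (d z - avg F k z + e)"
          by (simp add: sum.distrib sum_subtractf sum_eq_avg algebra_simps)
        with k show "\<exists>k\<ge>1. 0 \<le> (\<Sum>i<k. d ((S ^^ i) z) - F ((S ^^ i) z) + e)" by auto
      qed
    qed (use int d_int in auto)
    also have "(\<integral>z. d z - F z + e \<partial>N) = (\<integral>z. d z \<partial>N) - (\<integral>z. F z \<partial>N) + e"
      using int d_int by (simp add: prob_space)
    finally show "(\<integral>z. F z \<partial>N) \<le> (\<integral>z. d z \<partial>N) + e" by simp
  qed
  have "(\<integral>z. d z \<partial>N) \<le> (\<integral>z. g z \<partial>N)"
    by (rule integral_mono_AE) (use gd d_int g_int in auto)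
  with g_le d_ge have eq: "(\<integral>z. g z \<partial>N) = (\<integral>z. F z \<partial>N)" "(\<integral>z. g z - d z \<partial>N) = 0"
    using g_int d_int by auto
  have "AE z in N. g z - d z = 0"
    using integral_nonneg_eq_0_iff_AE[of N "\<lambda>z. g z - d z"] gd g_int d_int eq(2) by auto
  with gd have conv: "AE z in N. (\<lambda>n. avg F n z) \<longlonglongrightarrow> g z"
  proof eventually_elim
    case (elim z)
    then have "(\<lambda>n. ereal (avg F n z)) \<longlonglongrightarrow> ereal (g z)"
      by (intro Liminf_eq_Limsup) (auto simp: L_def l_def)
    then show ?case by simp
  qed
  \<comment> \<open>Scheffe: convergence almost everywhere improves to L1 convergence because the
    norms of the averages never exceed that of the limit. They agree with it for
    \<open>n \<ge> 1\<close>, and for \<open>n = 0\<close> the average is 0.\<close>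
  have "(\<lambda>n. \<integral>\<^sup>+z. norm (avg F n z - g z) \<partial>N) \<longlonglongrightarrow> 0"
  proof (rule Scheffe_lemma2[OF _ g_int conv])
    show "(\<integral>\<^sup>+z. norm (avg F n z) \<partial>N) \<le> (\<integral>\<^sup>+z. norm (g z) \<partial>N)" for n
    proof (cases "n \<ge> 1")
      case True
      have "(\<integral>\<^sup>+z. norm (avg F n z) \<partial>N) = ennreal (\<integral>z. avg F n z \<partial>N)"
        by (subst nn_integral_eq_integral)
          (auto simp: integrable_avg int avg_nonneg nonneg)
      also have "\<dots> = ennreal (\<integral>z. g z \<partial>N)" by (simp only: integral_avg[OF int True] eq(1))
      also have "\<dots> = (\<integral>\<^sup>+z. norm (g z) \<partial>N)"
        by (subst nn_integral_eq_integral) (auto simp: g_int g_nonneg)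
      finally show ?thesis by simp
    next
      case False
      then have "avg F n z = 0" for z by (simp add: avg_def not_le)
      then show ?thesis by simp
    qed
  qed measurable
  then have "(\<lambda>n. ennreal (\<integral>z. \<bar>avg F n z - g z\<bar> \<partial>N)) \<longlonglongrightarrow> ennreal 0"
    by (subst (asm) nn_integral_eq_integral) (auto simp: integrable_avg int g_int)
  then have "(\<lambda>n. \<integral>z. \<bar>avg F n z - g z\<bar> \<partial>N) \<longlonglongrightarrow> 0"
    by (subst (asm) tendsto_ennreal_iff) auto
  with g_int g_nonneg conv show thesis by (rule that)
qed

end

section \<open>The space of square-integrable functions\<close>

text \<open>The inequality is Jensen's, read off from the nonnegative variance of
  \<open>cmod (h x)\<close>. It makes every L2 net of the orbit an L1 net.\<close>

lemma (in prob_space)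
  assumes "h \<in> L2_fun M"
  shows L2_fun_integrable: "integrable M h"
    and integral_cmod_le_L2_norm: "(\<integral>x. cmod (h x) \<partial>M) \<le> L2_norm M h"
proof -
  have [measurable]: "h \<in> borel_measurable M" and sq: "integrable M (\<lambda>x. (cmod (h x))\<^sup>2)"
    using assms by (auto simp: L2_fun_def)
  have i: "integrable M (\<lambda>x. cmod (h x))"
    by (rule square_integrable_imp_integrable) (use sq in auto)
  then show "integrable M h" by (simp add: integrable_norm_iff)
  have "0 \<le> variance (\<lambda>x. cmod (h x))" by (rule variance_positive)
  then have "(\<integral>x. cmod (h x) \<partial>M)\<^sup>2 \<le> (L2_norm M h)\<^sup>2"
    using i sq by (simp add: variance_eq L2_norm_sq)
  then show "(\<integral>x. cmod (h x) \<partial>M) \<le> L2_norm M h"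
    by (rule power2_le_imp_le) (rule L2_norm_nonneg)
qed

lemma L2_norm_minus_commute: "L2_norm M (\<lambda>x. f x - g x) = L2_norm M (\<lambda>x. g x - f x)"
  by (simp add: L2_norm_def norm_minus_commute)

text \<open>Riesz-Fischer. An L2 Cauchy sequence is L1 Cauchy, so a subsequence converges almost
  everywhere; Fatou's lemma along that subsequence carries the Cauchy bound over to the limit
  function.\<close>

lemma mcomplete_L2:
  assumes "prob_space M"
  shows "Metric_space.mcomplete (L2_space M) (L2_dist M)"
proof -
  interpret prob_space M by fact
  interpret L: Metric_space "L2_space M" "L2_dist M" by (rule Metric_space_L2)
  have "\<exists>F. limitin L.mtopology \<sigma> F sequentially" if \<sigma>: "L.MCauchy \<sigma>" for \<sigma>
  proof -
    have "\<exists>u. u \<in> L2_fun M \<and> \<sigma> n = L2_class M u" for n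
    proof -
      have "\<sigma> n \<in> L2_space M" using \<sigma> by (auto simp: L.MCauchy_def)
      then show ?thesis by (metis L2_spaceE)
    qed
    then obtain s where s: "\<And>n. s n \<in> L2_fun M" "\<And>n. \<sigma> n = L2_class M (s n)" by metis
    have [measurable]: "s n \<in> borel_measurable M" for n using s(1)[of n] by (simp add: L2_fun_def)
    have cau: "\<exists>K. \<forall>i\<ge>K. \<forall>j\<ge>K. L2_norm M (\<lambda>x. s i x - s j x) < e" if "e > 0" for e
      using \<sigma> that unfolding L.MCauchy_def by (metis s L2_dist_class)
    obtain r where r: "strict_mono r" "AE x in M. Cauchy (\<lambda>i. s (r i) x)"
    proof (rule cauchy_L1_AE_cauchy_subseq[of M s])
      show "integrable M (s n)" for n by (rule L2_fun_integrable) (rule s)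
      show "\<exists>K. \<forall>i\<ge>K. \<forall>j\<ge>K. (\<integral>x. norm (s i x - s j x) \<partial>M) < e" if "e > 0" for e
        using cau[OF that] integral_cmod_le_L2_norm[OF L2_fun_diff[OF s(1) s(1)]]
        by (meson order_le_less_trans)
    qed
    define g where "g x = lim (\<lambda>i. s (r i) x)" for x
    have [measurable]: "g \<in> borel_measurable M" unfolding g_def by measurable
    have lim: "AE x in M. (\<lambda>i. s (r i) x) \<longlonglongrightarrow> g x"
      using r(2) by eventually_elim (simp add: g_def Cauchy_convergent convergent_LIMSEQ_iff[symmetric])
    have close: "(\<lambda>x. s i x - g x) \<in> L2_fun M \<and> L2_norm M (\<lambda>x. s i x - g x) \<le> e"
      if e: "e > 0" and K: "\<forall>i\<ge>K. \<forall>j\<ge>K. L2_norm M (\<lambda>x. s i x - s j x) < e" and "i \<ge> K" for e K i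
    proof -
      have "(\<integral>\<^sup>+x. ennreal ((cmod (s i x - g x))\<^sup>2) \<partial>M)
          = (\<integral>\<^sup>+x. liminf (\<lambda>k. ennreal ((cmod (s i x - s (r k) x))\<^sup>2)) \<partial>M)"
      proof (rule nn_integral_cong_AE, use lim in eventually_elim)
        case (elim x)
        have "(\<lambda>k. ennreal ((cmod (s i x - s (r k) x))\<^sup>2)) \<longlonglongrightarrow> ennreal ((cmod (s i x - g x))\<^sup>2)"
          using elim by (intro tendsto_intros) auto
        then show ?case by (intro lim_imp_Liminf[symmetric]) auto
      qed
      also have "\<dots> \<le> liminf (\<lambda>k. \<integral>\<^sup>+x. ennreal ((cmod (s i x - s (r k) x))\<^sup>2) \<partial>M)"
        by (rule nn_integral_liminf) measurable
      also have "\<dots> \<le> ennreal (e\<^sup>2)"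
      proof -
        have "(\<integral>\<^sup>+x. ennreal ((cmod (s i x - s (r k) x))\<^sup>2) \<partial>M) \<le> ennreal (e\<^sup>2)" if "k \<ge> K" for k
        proof -
          have "r k \<ge> K" using seq_suble[OF r(1), of k] that by simp
          then have "L2_norm M (\<lambda>x. s i x - s (r k) x) \<le> e" using K \<open>i \<ge> K\<close> by (simp add: less_imp_le)
          then have "(L2_norm M (\<lambda>x. s i x - s (r k) x))\<^sup>2 \<le> e\<^sup>2"
            by (intro power_mono L2_norm_nonneg)
          moreover have "integrable M (\<lambda>x. (cmod (s i x - s (r k) x))\<^sup>2)"
            using L2_fun_diff[OF s(1) s(1), of i "r k"] by (simp add: L2_fun_def)
          ultimately show ?thesis
            by (simp add: nn_integral_eq_integral L2_norm_sq ennreal_leI)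
        qed
        then have "liminf (\<lambda>k. \<integral>\<^sup>+x. ennreal ((cmod (s i x - s (r k) x))\<^sup>2) \<partial>M)
            \<le> liminf (\<lambda>k. ennreal (e\<^sup>2))"
          by (intro Liminf_mono eventually_sequentiallyI[of K])
        then show ?thesis by (simp add: Liminf_const)
      qed
      finally have nn: "(\<integral>\<^sup>+x. ennreal ((cmod (s i x - g x))\<^sup>2) \<partial>M) \<le> ennreal (e\<^sup>2)" .
      then have int: "integrable M (\<lambda>x. (cmod (s i x - g x))\<^sup>2)"
        by (intro integrableI_nonneg) (auto simp: less_top[symmetric] top_unique)
      with nn have "(L2_norm M (\<lambda>x. s i x - g x))\<^sup>2 \<le> e\<^sup>2"
        by (simp add: nn_integral_eq_integral L2_norm_sq)
      then have "L2_norm M (\<lambda>x. s i x - g x) \<le> e"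
        by (rule power2_le_imp_le) (use e in simp)
      with int show ?thesis by (simp add: L2_fun_def)
    qed
    obtain K where "\<forall>i\<ge>K. \<forall>j\<ge>K. L2_norm M (\<lambda>x. s i x - s j x) < 1" using cau[of 1] by auto
    then have "(\<lambda>x. s K x - g x) \<in> L2_fun M" using close[of 1 K K] by simp
    from L2_fun_diff[OF s(1)[of K] this] have g: "g \<in> L2_fun M" by simp
    have "limitin L.mtopology \<sigma> (L2_class M g) sequentially"
      unfolding L.limitin_metric
    proof (intro conjI allI impI)
      have mem: "L2_class M u \<in> L2_space M" if "u \<in> L2_fun M" for u
        using that by (auto simp: L2_class_def L2_space_def intro: quotientI)
      then show "L2_class M g \<in> L2_space M" using g by simp
      fix e :: real assume "e > 0"
      then obtain K where K: "\<forall>i\<ge>K. \<forall>j\<ge>K. L2_norm M (\<lambda>x. s i x - s j x) < e / 2"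
        using cau[of "e / 2"] by auto
      show "\<forall>\<^sub>F n in sequentially. \<sigma> n \<in> L2_space M \<and> L2_dist M (\<sigma> n) (L2_class M g) < e"
      proof (rule eventually_sequentiallyI[of K])
        fix i assume "i \<ge> K"
        with close[OF _ K this] \<open>e > 0\<close>
        show "\<sigma> i \<in> L2_space M \<and> L2_dist M (\<sigma> i) (L2_class M g) < e"
          using mem[OF s(1)[of i]] by (simp add: s(2) L2_dist_class[OF s(1) g])
      qed
    qed
    then show ?thesis by blast
  qed
  then show ?thesis by (simp add: L.mcomplete_def)
qed

text \<open>Completeness reduces compactness of the closure to total boundedness, whose centres lie
  in the set itself; hence they are given by a finite set \<open>J\<close> of indices. This removes
  the quotient and the topology from the rest of the proof.\<close>

lemma compactin_L2_closure_iff: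
  assumes "prob_space M" and h: "\<And>n. h n \<in> L2_fun M"
  shows "compactin (L2_topology M) (L2_topology M closure_of (range (\<lambda>n. L2_class M (h n)))) \<longleftrightarrow>
    (\<forall>r>0. \<exists>J. finite J \<and> (\<forall>n. \<exists>j\<in>J. L2_norm M (\<lambda>x. h n x - h j x) < r))"
proof -
  interpret L: Metric_space "L2_space M" "L2_dist M" by (rule Metric_space_L2)
  let ?c = "\<lambda>n. L2_class M (h n)"
  have mem: "?c n \<in> L2_space M" for n
    using h by (auto simp: L2_class_def L2_space_def intro: quotientI)
  have ball: "?c n \<in> L.mball (?c j) r \<longleftrightarrow> L2_norm M (\<lambda>x. h n x - h j x) < r" for n j r
    using mem by (simp add: L2_dist_class[OF h h] L2_norm_minus_commute[of M "h j"])
  have "compactin (L2_topology M) (L2_topology M closure_of range ?c) \<longleftrightarrow> L.mtotally_bounded (range ?c)"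
    using mem L.mtotally_bounded_eq_compact_closure_of[OF mcomplete_L2[OF assms(1)]]
    by (auto simp: L2_topology_def)
  also have "\<dots> \<longleftrightarrow> (\<forall>r>0. \<exists>J. finite J \<and> (\<forall>n. \<exists>j\<in>J. ?c n \<in> L.mball (?c j) r))"
    unfolding L.mtotally_bounded_def
  proof (intro all_cong1 imp_cong refl iffI)
    fix r :: real
    assume "\<exists>K. finite K \<and> K \<subseteq> range ?c \<and> range ?c \<subseteq> (\<Union>x\<in>K. L.mball x r)"
    then obtain K where K: "finite K" "K \<subseteq> range ?c" "range ?c \<subseteq> (\<Union>x\<in>K. L.mball x r)" by blast
    then obtain J where "finite J" "K = ?c ` J" by (meson finite_subset_image)
    have "\<exists>j\<in>J. ?c n \<in> L.mball (?c j) r" for n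
    proof -
      have "?c n \<in> (\<Union>x\<in>?c ` J. L.mball x r)"
        using K(3) unfolding \<open>K = ?c ` J\<close> by (rule subsetD) (rule rangeI)
      then obtain x where x: "x \<in> ?c ` J" "?c n \<in> L.mball x r" by (rule UN_E)
      from x(1) obtain j where "x = ?c j" "j \<in> J" by (rule imageE)
      with x(2) show ?thesis by (intro bexI[of _ j]) (simp_all only:)
    qed
    with \<open>finite J\<close> show "\<exists>J. finite J \<and> (\<forall>n. \<exists>j\<in>J. ?c n \<in> L.mball (?c j) r)" by (intro exI conjI allI)
  next
    fix r :: real
    assume "\<exists>J. finite J \<and> (\<forall>n. \<exists>j\<in>J. ?c n \<in> L.mball (?c j) r)"
    then obtain J where "finite J" "\<forall>n. \<exists>j\<in>J. ?c n \<in> L.mball (?c j) r" by blast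
    then have "finite (?c ` J)" "?c ` J \<subseteq> range ?c" "range ?c \<subseteq> (\<Union>x\<in>?c ` J. L.mball x r)"
      by (simp, blast, force)
    then show "\<exists>K. finite K \<and> K \<subseteq> range ?c \<and> range ?c \<subseteq> (\<Union>x\<in>K. L.mball x r)"
      by (intro exI conjI)
  qed
  finally show ?thesis by (simp only: ball)
qed

text \<open>Below a cutoff \<open>C\<close> the squared difference is at most \<open>2 * C\<close>
  times the difference. What remains are the tails of the squares, and these depend only on the
  distribution, so one \<open>C\<close> serves all \<open>u\<close> and \<open>v\<close> distributed
  like \<open>f\<close>.\<close>

lemma (in prob_space) L2_norm_small_if_L1_small:
  assumes f: "f \<in> L2_fun M" and e: "0 < e"
  obtains d where "d > 0"
    "\<And>u v. u \<in> borel_measurable M \<Longrightarrow> v \<in> borel_measurable M \<Longrightarrow>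
      distr M borel u = distr M borel f \<Longrightarrow> distr M borel v = distr M borel f \<Longrightarrow>
      (\<integral>x. cmod (u x - v x) \<partial>M) < d \<Longrightarrow> L2_norm M (\<lambda>x. u x - v x) < e"
proof -
  have [measurable]: "f \<in> borel_measurable M" and fi: "integrable M (\<lambda>x. (cmod (f x))\<^sup>2)"
    using f by (auto simp: L2_fun_def)
  define \<phi> where "\<phi> C a = (if cmod a > C then (cmod a)\<^sup>2 else 0)" for C :: real and a
  have [measurable]: "\<phi> C \<in> borel_measurable borel" for C unfolding \<phi>_def by measurable
  \<comment> \<open>If neither modulus exceeds \<open>C\<close>, the difference is at most
    \<open>2 * C\<close>; otherwise it is at most twice the larger modulus, whose square is then
    counted by its own tail.\<close>
  have bound: "(cmod (a - b))\<^sup>2 \<le> 2 * C * cmod (a - b) + 4 * \<phi> C a + 4 * \<phi> C b" if "C > 0" for a b C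
  proof -
    have tri: "cmod (a - b) \<le> cmod a + cmod b" by (rule norm_triangle_ineq4)
    consider "cmod a \<le> C" "cmod b \<le> C" | "cmod a > C" "cmod b \<le> cmod a" | "cmod b > C" "cmod a \<le> cmod b"
      by linarith
    then show ?thesis
    proof cases
      case 1
      then have "cmod (a - b) * cmod (a - b) \<le> (2 * C) * cmod (a - b)"
        using tri by (intro mult_right_mono) auto
      with 1 show ?thesis by (simp add: power2_eq_square \<phi>_def)
    next
      case 2
      then have "(cmod (a - b))\<^sup>2 \<le> (2 * cmod a)\<^sup>2" using tri by (intro power_mono) auto
      then have "(cmod (a - b))\<^sup>2 \<le> 4 * \<phi> C a" using 2 by (simp add: \<phi>_def power2_eq_square)
      moreover have "0 \<le> \<phi> C b" "0 \<le> 2 * C * cmod (a - b)" using that by (auto simp: \<phi>_def)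
      ultimately show ?thesis by linarith
    next
      case 3
      then have "(cmod (a - b))\<^sup>2 \<le> (2 * cmod b)\<^sup>2" using tri by (intro power_mono) auto
      then have "(cmod (a - b))\<^sup>2 \<le> 4 * \<phi> C b" using 3 by (simp add: \<phi>_def power2_eq_square)
      moreover have "0 \<le> \<phi> C a" "0 \<le> 2 * C * cmod (a - b)" using that by (auto simp: \<phi>_def)
      ultimately show ?thesis by linarith
    qed
  qed
  have \<phi>_le: "\<bar>\<phi> C a\<bar> \<le> (cmod a)\<^sup>2" for C a by (simp add: \<phi>_def)
  have "(\<lambda>n. \<integral>x. \<phi> (real n) (f x) \<partial>M) \<longlonglongrightarrow> (\<integral>x. 0 \<partial>M)"
  proof (rule integral_dominated_convergence[OF _ _ fi])
    show "AE x in M. (\<lambda>n. \<phi> (real n) (f x)) \<longlonglongrightarrow> 0"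
    proof (rule AE_I2)
      fix x
      obtain k where "cmod (f x) \<le> real k" using real_arch_simple by blast
      then have "\<forall>\<^sub>F n in sequentially. \<phi> (real n) (f x) = 0"
        by (intro eventually_sequentiallyI[of k]) (auto simp: \<phi>_def)
      then show "(\<lambda>n. \<phi> (real n) (f x)) \<longlonglongrightarrow> 0" by (rule tendsto_eventually)
    qed
  qed (use \<phi>_le in auto)
  then have "\<forall>\<^sub>F n in sequentially. (\<integral>x. \<phi> (real n) (f x) \<partial>M) < e\<^sup>2 / 16"
    using e by (intro order_tendstoD) auto
  from eventually_happens'[OF sequentially_bot eventually_conj[OF this eventually_ge_at_top[of 1]]]
  obtain n where "n \<ge> 1" and n: "(\<integral>x. \<phi> (real n) (f x) \<partial>M) < e\<^sup>2 / 16"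
    by (elim exE conjE)
  define C where "C = real n"
  have C: "C > 0" "(\<integral>x. \<phi> C (f x) \<partial>M) < e\<^sup>2 / 16" using \<open>n \<ge> 1\<close> n by (auto simp: C_def)
  show thesis
  \<comment> \<open>The L1 term contributes at most half of the square of \<open>e\<close>, and each
    of the two tails at most a quarter.\<close>
  proof (rule that[of "e\<^sup>2 / (4 * C)"])
    show "e\<^sup>2 / (4 * C) > 0" using e C by simp
    fix u v assume [measurable]: "u \<in> borel_measurable M" "v \<in> borel_measurable M"
      and d: "distr M borel u = distr M borel f" "distr M borel v = distr M borel f"
      and small: "(\<integral>x. cmod (u x - v x) \<partial>M) < e\<^sup>2 / (4 * C)"
    have w: "w \<in> L2_fun M \<and> integrable M (\<lambda>x. \<phi> C (w x)) \<and> (\<integral>x. \<phi> C (w x) \<partial>M) < e\<^sup>2 / 16"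
      if [measurable]: "w \<in> borel_measurable M" and dw: "distr M borel w = distr M borel f" for w
    proof -
      have "integrable (distr M borel f) (\<lambda>a. (cmod a)\<^sup>2)" using fi by (subst integrable_distr_eq) auto
      then have 1: "integrable M (\<lambda>x. (cmod (w x))\<^sup>2)"
        unfolding dw[symmetric] by (subst (asm) integrable_distr_eq) auto
      then have 2: "integrable M (\<lambda>x. \<phi> C (w x))"
        by (rule Bochner_Integration.integrable_bound) (use \<phi>_le in auto)
      have "(\<integral>x. \<phi> C (w x) \<partial>M) = (\<integral>a. \<phi> C a \<partial>distr M borel w)"
        by (rule integral_distr[symmetric]) measurable
      also have "\<dots> = (\<integral>x. \<phi> C (f x) \<partial>M)"
        unfolding dw by (rule integral_distr) measurable
      finally show ?thesis using 1 2 C by (simp add: L2_fun_def)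
    qed
    note wu = w[OF _ d(1)] and wv = w[OF _ d(2)]
    have L: "(\<lambda>x. u x - v x) \<in> L2_fun M" using wu wv by (intro L2_fun_diff) auto
    have "(L2_norm M (\<lambda>x. u x - v x))\<^sup>2
        \<le> (\<integral>x. 2 * C * cmod (u x - v x) + 4 * \<phi> C (u x) + 4 * \<phi> C (v x) \<partial>M)"
      unfolding L2_norm_sq
    proof (rule integral_mono)
      show "integrable M (\<lambda>x. (cmod (u x - v x))\<^sup>2)" using L by (simp add: L2_fun_def)
      show "integrable M (\<lambda>x. 2 * C * cmod (u x - v x) + 4 * \<phi> C (u x) + 4 * \<phi> C (v x))"
        using wu wv L2_fun_integrable[OF L] by auto
    qed (rule bound[OF C(1)])
    also have "\<dots> = 2 * C * (\<integral>x. cmod (u x - v x) \<partial>M) + 4 * (\<integral>x. \<phi> C (u x) \<partial>M) + 4 * (\<integral>x. \<phi> C (v x) \<partial>M)"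
      using wu wv L2_fun_integrable[OF L] by simp
    also have "\<dots> < e\<^sup>2 / 2 + e\<^sup>2 / 4 + e\<^sup>2 / 4"
    proof -
      have "2 * C * (\<integral>x. cmod (u x - v x) \<partial>M) < 2 * C * (e\<^sup>2 / (4 * C))"
        using small C by (intro mult_strict_left_mono) auto
      also have "\<dots> = e\<^sup>2 / 2" using C by simp
      finally show ?thesis using wu wv by simp
    qed
    finally have "(L2_norm M (\<lambda>x. u x - v x))\<^sup>2 < e\<^sup>2" by simp
    then show "L2_norm M (\<lambda>x. u x - v x) < e" by (rule power2_less_imp_less) (use e in simp)
  qed
qed

section \<open>Finite Borel measures on metric spaces\<close>

text \<open>\<open>d\<close> is a Lebesgue number of the cover by the open sets
  \<open>- (\<Union>j\<in>I - {i}. C j)\<close>: a ball of radius \<open>d\<close> around a point of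
  the union avoids all members but one. This turns smallness within each cell into smallness for all
  close pairs of the union.\<close>

lemma compact_disjoint_family_separated:
  fixes C :: "'i \<Rightarrow> 'a::metric_space set"
  assumes fin: "finite I" and C: "\<And>i. i \<in> I \<Longrightarrow> compact (C i)" and disj: "disjoint_family_on C I"
  obtains d where "d > 0" "\<And>i j x y. i \<in> I \<Longrightarrow> j \<in> I \<Longrightarrow> x \<in> C i \<Longrightarrow> y \<in> C j \<Longrightarrow> dist x y < d \<Longrightarrow> i = j"
proof -
  let ?U = "\<Union>i\<in>I. C i"
  let ?O = "(\<lambda>i. - (\<Union>j\<in>I - {i}. C j)) ` I"
  have "compact ?U" using fin C by (intro compact_UN) auto
  moreover have "?U \<subseteq> \<Union>?O"
  proof
    fix x assume "x \<in> ?U"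
    then obtain i where i: "i \<in> I" "x \<in> C i" by auto
    then have "x \<notin> C j" if "j \<in> I - {i}" for j
      using that disj by (auto simp: disjoint_family_on_def)
    then have "x \<in> - (\<Union>j\<in>I - {i}. C j)" by auto
    with i show "x \<in> \<Union>?O" by blast
  qed
  moreover have "open B" if "B \<in> ?O" for B
  proof -
    have "closed (\<Union>j\<in>I - {i}. C j)" for i
      using fin C by (intro closed_UN) (auto intro: compact_imp_closed)
    moreover from that obtain i where "B = - (\<Union>j\<in>I - {i}. C j)" by (rule imageE)
    ultimately show ?thesis by (simp only: open_Compl)
  qed
  ultimately obtain d where d: "d > 0" "\<And>x. x \<in> ?U \<Longrightarrow> \<exists>B\<in>?O. ball x d \<subseteq> B"
    using Heine_Borel_lemma[of ?U ?O] by metis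
  show thesis
  proof (rule that[OF d(1)])
    fix i j x y assume *: "i \<in> I" "j \<in> I" "x \<in> C i" "y \<in> C j" "dist x y < d"
    then obtain k where k: "k \<in> I" "ball x d \<subseteq> - (\<Union>j\<in>I - {k}. C j)" using d(2)[of x] by auto
    have "x \<in> - (\<Union>j\<in>I - {k}. C j)" "y \<in> - (\<Union>j\<in>I - {k}. C j)"
      by (rule subsetD[OF k(2)]; use d(1) *(5) in simp)+
    with * have "i = k" "j = k" by blast+
    then show "i = j" by simp
  qed
qed

text \<open>The regularity theorems of the library need a Polish type class, which is not available for
  a type that is compact only by assumption.\<close>

lemma borel_regular_metric:
  fixes M :: "'a::metric_space measure"
  assumes "finite_measure M" and sets: "sets M = sets borel" and A: "A \<in> sets M" and e: "0 < e"
  obtains C U where "closed C" "open U" "C \<subseteq> A" "A \<subseteq> U" "measure M (U - C) < e"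
proof -
  interpret finite_measure M by fact
  have sp: "space M = UNIV" using sets_eq_imp_space_eq[OF sets] by simp
  let ?P = "\<lambda>A e. \<exists>C U. closed C \<and> open U \<and> C \<subseteq> A \<and> A \<subseteq> U \<and> measure M (U - C) < e"
  have [measurable]: "closed C \<Longrightarrow> C \<in> sets M" "open C \<Longrightarrow> C \<in> sets M" for C
    using sets by auto
  have "A \<in> sigma_sets UNIV {S. closed S}"
    using A unfolding sets borel_eq_closed by (simp add: sets_measure_of)
  then have "\<forall>e>0. ?P A e"
  proof induction
    case (Basic S)
    then have S: "closed S" by simp
    show ?case
    proof (intro allI impI)
      fix e :: real assume "e > 0"
      \<comment> \<open>A closed set is the intersection of its shrinking open neighbourhoods, and
        continuity from above applies because the measure is finite.\<close>
      define U where "U n = (\<Union>x\<in>S. ball x (inverse (real (Suc n))))" for n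
      have U [measurable]: "open (U n)" for n unfolding U_def by auto
      have "(\<Inter>n. U n) = S"
      proof
        show "S \<subseteq> (\<Inter>n. U n)" unfolding U_def by force
        show "(\<Inter>n. U n) \<subseteq> S"
        proof
          fix x assume x: "x \<in> (\<Inter>n. U n)"
          have "x \<in> closure S"
            unfolding closure_approachable
          proof (intro allI impI)
            fix e :: real assume "e > 0"
            then obtain n where n: "inverse (real (Suc n)) < e" using reals_Archimedean by blast
            from x have "x \<in> U n" by auto
            then obtain y where "y \<in> S" "dist y x < inverse (real (Suc n))" by (auto simp: U_def)
            with n show "\<exists>y\<in>S. dist y x < e" by force
          qed
          with S show "x \<in> S" by simp
        qed
      qed
      moreover have "(\<lambda>n. measure M (U n)) \<longlonglongrightarrow> measure M (\<Inter>n. U n)"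
      proof (rule finite_Lim_measure_decseq)
        show "range U \<subseteq> sets M" by auto
        show "decseq U"
        proof (rule decseq_SucI)
          show "U (Suc n) \<subseteq> U n" for n
          proof -
            have "inverse (real (Suc (Suc n))) \<le> inverse (real (Suc n))" by (simp add: field_simps)
            then have "ball x (inverse (real (Suc (Suc n)))) \<subseteq> ball x (inverse (real (Suc n)))" for x :: 'a
              by (rule subset_ball)
            then show ?thesis unfolding U_def by blast
          qed
        qed
      qed
      ultimately have "(\<lambda>n. measure M (U n)) \<longlonglongrightarrow> measure M S" by simp
      then have "eventually (\<lambda>n. measure M (U n) < measure M S + e) sequentially"
        using \<open>e > 0\<close> by (intro order_tendstoD) auto
      then obtain n where n: "measure M (U n) < measure M S + e"
        by (meson eventually_happens' sequentially_bot)
      have "S \<subseteq> U n" unfolding U_def by force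
      then have "measure M (U n - S) = measure M (U n) - measure M S"
        using S by (intro finite_measure_Diff) auto
      then have small: "measure M (U n - S) < e" using n by simp
      show "?P S e"
      proof (intro exI conjI)
        show "closed S" "open (U n)" "S \<subseteq> S" "S \<subseteq> U n" "measure M (U n - S) < e"
          by (simp_all add: S U \<open>S \<subseteq> U n\<close> small)
      qed
    qed
  next
    case Empty
    then show ?case by (auto intro!: exI[of _ "{}"])
  next
    case (Compl A)
    show ?case
    proof (intro allI impI)
      fix e :: real assume "e > 0"
      from Compl.IH[rule_format, OF this] obtain C U
        where *: "closed C" "open U" "C \<subseteq> A" "A \<subseteq> U" "measure M (U - C) < e"
        by (elim exE conjE)
      have "- C - - U = U - C" by auto
      with * have "closed (- U)" "open (- C)" "- U \<subseteq> UNIV - A" "UNIV - A \<subseteq> - C"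
        "measure M (- C - - U) < e" by auto
      then show "?P (UNIV - A) e" by (intro exI conjI)
    qed
  next
    case (Union A)
    show ?case
    proof (intro allI impI)
      fix e :: real assume e: "e > 0"
      \<comment> \<open>The approximation errors add up to \<open>e / 2\<close>. The other half pays
        for cutting the union of the \<open>C n\<close>, which need not be closed, down to a finite
        union.\<close>
      have "\<exists>C U. closed C \<and> open U \<and> C \<subseteq> A n \<and> A n \<subseteq> U \<and> measure M (U - C) < e / 2 * (1/2)^Suc n" for n
        by (rule Union.IH[rule_format]) (use e in simp)
      then obtain C U where *: "\<And>n. closed (C n)" "\<And>n. open (U n)" "\<And>n. C n \<subseteq> A n" "\<And>n. A n \<subseteq> U n"
        "\<And>n. measure M (U n - C n) < e / 2 * (1/2)^Suc n" by metis
      have [measurable]: "C n \<in> sets M" "U n \<in> sets M" for n using *(1,2) by auto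
      have "(\<lambda>n. measure M (\<Union>i\<le>n. C i)) \<longlonglongrightarrow> measure M (\<Union>n. \<Union>i\<le>n. C i)"
        by (rule finite_Lim_measure_incseq) (auto simp: incseq_def, force)
      also have "(\<Union>n. \<Union>i\<le>n. C i) = (\<Union>n. C n)" by auto
      finally have "eventually (\<lambda>n. measure M (\<Union>n. C n) - e / 2 < measure M (\<Union>i\<le>n. C i)) sequentially"
        using e by (intro order_tendstoD) auto
      then obtain n where n: "measure M (\<Union>n. C n) - e / 2 < measure M (\<Union>i\<le>n. C i)"
        by (meson eventually_happens' sequentially_bot)
      have gs: "(\<lambda>n. e / 2 * (1/2)^Suc n) sums (e / 2)"
        using sums_mult[OF power_half_series, of "e / 2"] by simp
      have sm: "summable (\<lambda>n. measure M (U n - C n))"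
        by (rule summable_comparison_test'[OF sums_summable[OF gs]]) (use *(5) in \<open>auto intro: less_imp_le\<close>)
      have "measure M ((\<Union>n. U n) - (\<Union>n. C n)) \<le> measure M (\<Union>n. U n - C n)"
        by (intro finite_measure_mono) auto
      also have "\<dots> \<le> (\<Sum>n. measure M (U n - C n))"
        by (intro finite_measure_subadditive_countably sm) auto
      also have "\<dots> \<le> (\<Sum>n. e / 2 * (1/2)^Suc n)"
        by (intro suminf_le sm sums_summable[OF gs]) (use *(5) in \<open>auto intro: less_imp_le\<close>)
      also have "\<dots> = e / 2" using gs by (simp add: sums_iff)
      finally have 1: "measure M ((\<Union>n. U n) - (\<Union>n. C n)) \<le> e / 2" .
      have "measure M ((\<Union>n. C n) - (\<Union>i\<le>n. C i)) = measure M (\<Union>n. C n) - measure M (\<Union>i\<le>n. C i)"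
        by (intro finite_measure_Diff) auto
      with n have 2: "measure M ((\<Union>n. C n) - (\<Union>i\<le>n. C i)) < e / 2" by simp
      have "measure M ((\<Union>n. U n) - (\<Union>i\<le>n. C i)) \<le>
          measure M (((\<Union>n. U n) - (\<Union>n. C n)) \<union> ((\<Union>n. C n) - (\<Union>i\<le>n. C i)))"
        by (intro finite_measure_mono) auto
      also have "\<dots> \<le> measure M ((\<Union>n. U n) - (\<Union>n. C n)) + measure M ((\<Union>n. C n) - (\<Union>i\<le>n. C i))"
        by (intro measure_Un_le) auto
      finally have "measure M ((\<Union>n. U n) - (\<Union>i\<le>n. C i)) < e" using 1 2 by simp
      moreover have "closed (\<Union>i\<le>n. C i)" "open (\<Union>n. U n)"
        using *(1,2) by (auto intro: closed_UN)
      moreover have "(\<Union>i\<le>n. C i) \<subseteq> (\<Union>n. A n)" "(\<Union>n. A n) \<subseteq> (\<Union>n. U n)"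
        using *(3,4) by blast+
      ultimately show "?P (\<Union>n. A n) e" by (intro exI conjI)
    qed
  qed
  from this[rule_format, OF e] obtain C U
    where "closed C" "open U" "C \<subseteq> A" "A \<subseteq> U" "measure M (U - C) < e"
    by (elim exE conjE)
  then show thesis by (rule that)
qed

section \<open>Oscillation and mean distance\<close>

context measure_preserving
begin

sublocale P: pair_prob_space N N ..

lemma measure_preserving_product: "measure_preserving (N \<Otimes>\<^sub>M N) (\<lambda>(x, y). (S x, S y))"
proof (rule measure_preserving.intro)
  show "prob_space (N \<Otimes>\<^sub>M N)" by (rule P.P.prob_space_axioms)
  show "(\<lambda>(x, y). (S x, S y)) \<in> N \<Otimes>\<^sub>M N \<rightarrow>\<^sub>M N \<Otimes>\<^sub>M N" by measurable
  show "distr (N \<Otimes>\<^sub>M N) (N \<Otimes>\<^sub>M N) (\<lambda>(x, y). (S x, S y)) = N \<Otimes>\<^sub>M N"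
    using pair_measure_distr[OF meas_S meas_S] sigma_finite_measure_axioms by (simp add: distr_S)
qed

lemma product_iterate: "((\<lambda>(x, y). (S x, S y)) ^^ i) (x, y) = ((S ^^ i) x, (S ^^ i) y)"
  by (induction i) simp_all

lemma
  fixes a b :: "'a \<Rightarrow> real"
  assumes a: "integrable N a" and b: "integrable N b"
  shows integrable_product: "integrable (N \<Otimes>\<^sub>M N) (\<lambda>z. a (fst z) * b (snd z))"
    and integral_product: "(\<integral>z. a (fst z) * b (snd z) \<partial>(N \<Otimes>\<^sub>M N)) = (\<integral>x. a x \<partial>N) * (\<integral>x. b x \<partial>N)"
proof -
  have [measurable]: "a \<in> borel_measurable N" "b \<in> borel_measurable N" using a b by auto
  show i: "integrable (N \<Otimes>\<^sub>M N) (\<lambda>z. a (fst z) * b (snd z))"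
    by (rule P.Fubini_integrable) (use a b in \<open>auto simp: abs_mult\<close>)
  show "(\<integral>z. a (fst z) * b (snd z) \<partial>(N \<Otimes>\<^sub>M N)) = (\<integral>x. a x \<partial>N) * (\<integral>x. b x \<partial>N)"
    using P.integral_fst'[OF i] by simp
qed

lemma integrable_dist_product:
  fixes h :: "'a \<Rightarrow> complex"
  assumes h: "integrable N h"
  shows "integrable (N \<Otimes>\<^sub>M N) (\<lambda>z. cmod (h (fst z) - h (snd z)))"
proof (rule Bochner_Integration.integrable_bound)
  have [measurable]: "h \<in> borel_measurable N" using h by auto
  have one: "integrable N (\<lambda>_. 1 :: real)" by simp
  have n: "integrable N (\<lambda>x. cmod (h x))" using h by simp
  show "integrable (N \<Otimes>\<^sub>M N) (\<lambda>z. cmod (h (fst z)) * 1 + 1 * cmod (h (snd z)))"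
    by (intro Bochner_Integration.integrable_add integrable_product one n)
  show "(\<lambda>z. cmod (h (fst z) - h (snd z))) \<in> borel_measurable (N \<Otimes>\<^sub>M N)" by measurable
qed (auto simp: norm_triangle_ineq4)

lemma integrable_indicator_times:
  fixes a :: "'a \<Rightarrow> real"
  assumes "P \<in> sets N" "integrable N a"
  shows "integrable N (\<lambda>x. indicator P x * a x)"
  using integrable_mult_indicator[OF assms] by simp

lemma integrable_square_times:
  fixes F :: "'a \<times> 'a \<Rightarrow> real"
  assumes "P \<in> sets N" "integrable (N \<Otimes>\<^sub>M N) F"
  shows "integrable (N \<Otimes>\<^sub>M N) (\<lambda>z. indicator (P \<times> P) z * F z)"
proof -
  have "P \<times> P \<in> sets (N \<Otimes>\<^sub>M N)" using assms(1) by simp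
  from integrable_mult_indicator[OF this assms(2)] show ?thesis by simp
qed

text \<open>If \<open>P\<close> is a null set, then \<open>osc P h = 0\<close> by division by zero.\<close>

definition osc :: "'a set \<Rightarrow> ('a \<Rightarrow> complex) \<Rightarrow> real" where
  "osc P h = (\<integral>z. indicator (P \<times> P) z * cmod (h (fst z) - h (snd z)) \<partial>(N \<Otimes>\<^sub>M N)) / measure N P"

lemma osc_nonneg: "0 \<le> osc P h"
  unfolding osc_def by (intro divide_nonneg_nonneg integral_nonneg_AE) auto

text \<open>Up to a factor 2, \<open>osc P h\<close> is the L1 distance on \<open>P\<close> from
  \<open>h\<close> to the constants; this is one half and \<open>mean_osc_le\<close> the other.
  Dividing by \<open>measure N P\<close> only once gives \<open>osc\<close> the scale of an integral
  over \<open>P\<close>, so that it can be summed over cells.\<close>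

lemma osc_le:
  assumes P [measurable]: "P \<in> sets N" and h: "integrable N h"
  shows "osc P h \<le> 2 * (\<integral>x. indicator P x * cmod (h x - c) \<partial>N)"
proof (cases "measure N P = 0")
  case True
  then show ?thesis by (auto simp: osc_def intro!: integral_nonneg_AE)
next
  case False
  let ?a = "\<lambda>x. indicator P x * cmod (h x - c)" and ?b = "\<lambda>x. indicator P x :: real"
  have a: "integrable N ?a" by (intro integrable_indicator_times P) (use h in auto)
  have b: "integrable N ?b" by (rule integrable_real_indicator[OF P]) (simp add: emeasure_eq_measure)
  have "(\<integral>z. indicator (P \<times> P) z * cmod (h (fst z) - h (snd z)) \<partial>(N \<Otimes>\<^sub>M N))
      \<le> (\<integral>z. ?a (fst z) * ?b (snd z) + ?b (fst z) * ?a (snd z) \<partial>(N \<Otimes>\<^sub>M N))"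
  proof (rule integral_mono)
    show "integrable (N \<Otimes>\<^sub>M N) (\<lambda>z. indicator (P \<times> P) z * cmod (h (fst z) - h (snd z)))"
      by (intro integrable_square_times integrable_dist_product P h)
    show "integrable (N \<Otimes>\<^sub>M N) (\<lambda>z. ?a (fst z) * ?b (snd z) + ?b (fst z) * ?a (snd z))"
      by (intro Bochner_Integration.integrable_add integrable_product a b)
    fix z
    have "cmod (h (fst z) - h (snd z)) \<le> cmod (h (fst z) - c) + cmod (h (snd z) - c)"
      using norm_triangle_ineq4[of "h (fst z) - c" "h (snd z) - c"] by simp
    then show "indicator (P \<times> P) z * cmod (h (fst z) - h (snd z))
        \<le> ?a (fst z) * ?b (snd z) + ?b (fst z) * ?a (snd z)"
      by (auto simp: indicator_def)
  qed
  also have "\<dots> = 2 * measure N P * (\<integral>x. ?a x \<partial>N)"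
    unfolding Bochner_Integration.integral_add[OF integrable_product[OF a b] integrable_product[OF b a]]
      integral_product[OF a b] integral_product[OF b a] by simp
  finally show ?thesis
    using False measure_nonneg[of N P] unfolding osc_def
    by (simp add: less_le divide_le_eq mult.commute mult.left_commute)
qed

text \<open>For \<open>x\<close> in \<open>P\<close> the deviation of \<open>h x\<close> from the
  mean is the mean over \<open>y\<close> in \<open>P\<close> of \<open>h x - h y\<close>. Taking the
  norm inside and integrating over \<open>x\<close> produces \<open>osc P h\<close>.\<close>

lemma mean_osc_le:
  fixes h :: "'a \<Rightarrow> complex"
  assumes P [measurable]: "P \<in> sets N" and h: "integrable N h"
  shows "(\<integral>x. indicator P x * cmod (h x - (\<integral>y. indicator P y *\<^sub>R h y \<partial>N) / measure N P) \<partial>N) \<le> osc P h"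
proof (cases "measure N P = 0")
  case True
  then have "P \<in> null_sets N" by (simp add: null_sets_def emeasure_eq_measure)
  then have "AE x in N. x \<notin> P" by (rule AE_not_in)
  then have "(\<integral>x. indicator P x * cmod (h x - (\<integral>y. indicator P y *\<^sub>R h y \<partial>N) / measure N P) \<partial>N) = (\<integral>x. 0 \<partial>N)"
    using h by (intro integral_cong_AE) (auto elim: AE_mp)
  then show ?thesis by (simp add: osc_nonneg)
next
  case False
  then have \<mu>: "measure N P > 0" using measure_nonneg[of N P] by linarith
  let ?\<mu> = "measure N P" and ?a = "\<integral>y. indicator P y *\<^sub>R h y \<partial>N"
  let ?F = "\<lambda>z. indicator (P \<times> P) z * cmod (h (fst z) - h (snd z))"
  have [measurable]: "h \<in> borel_measurable N" using h by auto
  have F: "integrable (N \<Otimes>\<^sub>M N) ?F"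
    by (intro integrable_square_times integrable_dist_product P h)
  have Ph: "integrable N (\<lambda>y. indicator P y *\<^sub>R h y)" by (rule integrable_mult_indicator[OF P h])
  have "indicator P x * (?\<mu> * cmod (h x - ?a / ?\<mu>)) \<le> (\<integral>y. ?F (x, y) \<partial>N)" for x
  proof (cases "x \<in> P")
    case True
    have "?\<mu> * cmod (h x - ?a / ?\<mu>) = cmod (?\<mu> *\<^sub>R (h x - ?a / ?\<mu>))" by simp
    also have "?\<mu> *\<^sub>R (h x - ?a / ?\<mu>) = ?\<mu> *\<^sub>R h x - ?a"
      using \<mu> by (simp add: scaleR_conv_of_real field_simps)
    also have "\<dots> = (\<integral>y. indicator P y *\<^sub>R h x - indicator P y *\<^sub>R h y \<partial>N)"
    proof -
      have i: "integrable N (indicat_real P)"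
        by (rule integrable_real_indicator[OF P]) (simp add: emeasure_eq_measure)
      then have "(\<integral>y. indicator P y *\<^sub>R h x \<partial>N) = ?\<mu> *\<^sub>R h x"
        by (subst integral_scaleR_left) simp_all
      with i Ph show ?thesis by (subst Bochner_Integration.integral_diff) simp_all
    qed
    also have "cmod \<dots> \<le> (\<integral>y. cmod (indicator P y *\<^sub>R h x - indicator P y *\<^sub>R h y) \<partial>N)"
      by (rule integral_norm_bound)
    also have "\<dots> = (\<integral>y. ?F (x, y) \<partial>N)"
      by (rule Bochner_Integration.integral_cong) (use True in \<open>auto simp: indicator_def\<close>)
    finally show ?thesis using True by simp
  qed (auto intro!: integral_nonneg_AE)
  then have "(\<integral>x. indicator P x * (?\<mu> * cmod (h x - ?a / ?\<mu>)) \<partial>N) \<le> (\<integral>x. (\<integral>y. ?F (x, y) \<partial>N) \<partial>N)"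
    by (intro integral_mono P.integrable_fst'[OF F] integrable_indicator_times P) (use h in auto)
  also have "\<dots> = (\<integral>z. ?F z \<partial>(N \<Otimes>\<^sub>M N))" by (rule P.integral_fst'[OF F])
  also have "(\<integral>x. indicator P x * (?\<mu> * cmod (h x - ?a / ?\<mu>)) \<partial>N)
      = ?\<mu> * (\<integral>x. indicator P x * cmod (h x - ?a / ?\<mu>) \<partial>N)"
    by (subst integral_mult_right_zero[symmetric]) (simp add: ac_simps)
  finally show ?thesis unfolding osc_def using \<mu> by (simp add: field_simps)
qed

text \<open>The two means over \<open>P\<close> are inserted between \<open>h\<close> and
  \<open>k\<close>. For functions of small oscillation the L1 distance on \<open>P\<close> is thus
  governed by one complex number each, which makes a finite classification possible.\<close>

lemma L1_dist_le_osc: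
  assumes P [measurable]: "P \<in> sets N" and h: "integrable N h" and k: "integrable N k"
  shows "(\<integral>x. indicator P x * cmod (h x - k x) \<partial>N) \<le>
    osc P h + osc P k + cmod ((\<integral>x. indicator P x *\<^sub>R h x \<partial>N) - (\<integral>x. indicator P x *\<^sub>R k x \<partial>N))"
    (is "?L \<le> _ + _ + cmod (?a - ?b)")
proof -
  let ?\<mu> = "measure N P"
  have i: "integrable N (\<lambda>x. indicator P x * cmod (h x - ?a / ?\<mu>))"
      "integrable N (\<lambda>x. indicator P x * cmod (k x - ?b / ?\<mu>))"
      "integrable N (\<lambda>x. indicator P x * cmod (h x - k x))"
    by (intro integrable_indicator_times P; use h k in simp)+
  have "?L \<le> (\<integral>x. indicator P x * cmod (h x - ?a / ?\<mu>) + indicator P x * cmod (k x - ?b / ?\<mu>)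
      + indicator P x * cmod (?a / ?\<mu> - ?b / ?\<mu>) \<partial>N)"
  proof (rule integral_mono[OF i(3)])
    show "integrable N (\<lambda>x. indicator P x * cmod (h x - ?a / ?\<mu>) + indicator P x * cmod (k x - ?b / ?\<mu>)
      + indicator P x * cmod (?a / ?\<mu> - ?b / ?\<mu>))"
      by (intro Bochner_Integration.integrable_add i integrable_indicator_times P) simp
    fix x
    have "h x - k x = (h x - ?a / ?\<mu>) - (k x - ?b / ?\<mu>) + (?a / ?\<mu> - ?b / ?\<mu>)" by simp
    then have "cmod (h x - k x) \<le> cmod (h x - ?a / ?\<mu>) + cmod (k x - ?b / ?\<mu>) + cmod (?a / ?\<mu> - ?b / ?\<mu>)"
      by (simp only:) (rule order_trans[OF norm_triangle_ineq add_right_mono[OF norm_triangle_ineq4]])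
    then show "indicator P x * cmod (h x - k x) \<le> indicator P x * cmod (h x - ?a / ?\<mu>)
        + indicator P x * cmod (k x - ?b / ?\<mu>) + indicator P x * cmod (?a / ?\<mu> - ?b / ?\<mu>)"
      by (auto simp: indicator_def)
  qed
  also have "\<dots> = (\<integral>x. indicator P x * cmod (h x - ?a / ?\<mu>) \<partial>N)
      + (\<integral>x. indicator P x * cmod (k x - ?b / ?\<mu>) \<partial>N) + ?\<mu> * cmod (?a / ?\<mu> - ?b / ?\<mu>)"
    using i by (simp add: less_top[symmetric])
  also have "?\<mu> * cmod (?a / ?\<mu> - ?b / ?\<mu>) \<le> cmod (?a - ?b)"
    by (cases "?\<mu> = 0") (simp_all add: diff_divide_distrib[symmetric] norm_divide)
  finally show ?thesis using mean_osc_le[OF P h] mean_osc_le[OF P k] by simp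
qed

text \<open>The upper limit occurring in \<open>mean_equicontinuous\<close>, as an extended
  pseudometric. Birkhoff's limit alone would carry no information at a chosen point, and such points
  are needed as centres.\<close>

definition mean_dist :: "('a \<Rightarrow> complex) \<Rightarrow> 'a \<Rightarrow> 'a \<Rightarrow> ereal" where
  "mean_dist f x y = limsup (\<lambda>n. ereal ((1 / real n) * (\<Sum>i<n. cmod (f ((S ^^ i) x) - f ((S ^^ i) y)))))"

lemma mean_dist_commute: "mean_dist f x y = mean_dist f y x"
  by (simp add: mean_dist_def norm_minus_commute)

lemma mean_dist_triangle: "mean_dist f x z \<le> mean_dist f x y + mean_dist f y z"
proof -
  let ?A = "\<lambda>x y n. (1 / real n) * (\<Sum>i<n. cmod (f ((S ^^ i) x) - f ((S ^^ i) y)))"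
  have "?A x z n \<le> ?A x y n + ?A y z n" for n
  proof -
    have "(\<Sum>i<n. cmod (f ((S ^^ i) x) - f ((S ^^ i) z)))
        \<le> (\<Sum>i<n. cmod (f ((S ^^ i) x) - f ((S ^^ i) y)) + cmod (f ((S ^^ i) y) - f ((S ^^ i) z)))"
      by (intro sum_mono order_trans[OF _ norm_triangle_ineq]) simp
    then show ?thesis
      by (simp add: sum.distrib divide_right_mono flip: add_divide_distrib)
  qed
  then have "mean_dist f x z \<le> limsup (\<lambda>n. ereal (?A x y n) + ereal (?A y z n))"
    unfolding mean_dist_def by (intro Limsup_mono always_eventually) simp
  also have "\<dots> \<le> mean_dist f x y + mean_dist f y z"
    unfolding mean_dist_def by (rule ereal_limsup_add_mono)
  finally show ?thesis .
qed

lemma mean_dist_measurable: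
  assumes [measurable]: "f \<in> borel_measurable N"
  shows "(\<lambda>z. mean_dist f (fst z) (snd z)) \<in> borel_measurable (N \<Otimes>\<^sub>M N)"
  unfolding mean_dist_def by measurable

text \<open>\<open>g\<close> is a real-valued integrable version of the mean distance. The last
  conclusion exchanges time averages with integration over \<open>P \<times> P\<close>, for which L1
  convergence is essential; it links the pointwise distance to the oscillation of the functions
  along the orbit.\<close>

theorem product_birkhoff:
  assumes f: "integrable N f"
  obtains g where "integrable (N \<Otimes>\<^sub>M N) g" "\<And>z. 0 \<le> g z"
    "AE z in N \<Otimes>\<^sub>M N. mean_dist f (fst z) (snd z) = ereal (g z)"
    "\<And>P. P \<in> sets N \<Longrightarrow> (\<lambda>n. (1 / real n) * (\<Sum>i<n. osc P (\<lambda>x. f ((S ^^ i) x)))) \<longlonglongrightarrow>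
      (\<integral>z. indicator (P \<times> P) z * g z \<partial>(N \<Otimes>\<^sub>M N)) / measure N P"
proof -
  interpret Q: measure_preserving "N \<Otimes>\<^sub>M N" "\<lambda>(x, y). (S x, S y)" by (rule measure_preserving_product)
  let ?F = "\<lambda>z. cmod (f (fst z) - f (snd z))"
  have F: "integrable (N \<Otimes>\<^sub>M N) ?F" by (rule integrable_dist_product[OF f])
  have avg: "Q.avg ?F n z = (1 / real n) * (\<Sum>i<n. cmod (f ((S ^^ i) (fst z)) - f ((S ^^ i) (snd z))))" for n z
    by (cases z) (simp add: Q.avg_def product_iterate)
  obtain g where g: "integrable (N \<Otimes>\<^sub>M N) g" "\<And>z. 0 \<le> g z"
    "AE z in N \<Otimes>\<^sub>M N. (\<lambda>n. Q.avg ?F n z) \<longlonglongrightarrow> g z"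
    "(\<lambda>n. \<integral>z. \<bar>Q.avg ?F n z - g z\<bar> \<partial>(N \<Otimes>\<^sub>M N)) \<longlonglongrightarrow> 0"
    by (rule Q.birkhoff[OF F]) auto
  show thesis
  proof (rule that[OF g(1,2)])
    show "AE z in N \<Otimes>\<^sub>M N. mean_dist f (fst z) (snd z) = ereal (g z)"
      using g(3)
    proof eventually_elim
      case (elim z)
      then have "(\<lambda>n. ereal (Q.avg ?F n z)) \<longlonglongrightarrow> ereal (g z)" by simp
      then show ?case
        unfolding mean_dist_def avg[symmetric] by (intro lim_imp_Limsup) auto
    qed
    fix P assume P [measurable]: "P \<in> sets N"
    let ?I = "\<lambda>z. indicator (P \<times> P) z :: real"
    have iF: "integrable (N \<Otimes>\<^sub>M N) (\<lambda>z. ?I z * Q.avg ?F n z)" for n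
      by (intro integrable_square_times P Q.integrable_avg F)
    have ig: "integrable (N \<Otimes>\<^sub>M N) (\<lambda>z. ?I z * g z)"
      by (intro integrable_square_times P g)
    have "(\<lambda>n. \<integral>z. ?I z * Q.avg ?F n z \<partial>(N \<Otimes>\<^sub>M N)) \<longlonglongrightarrow> (\<integral>z. ?I z * g z \<partial>(N \<Otimes>\<^sub>M N))"
    proof (rule LIM_zero_cancel, rule Lim_null_comparison[OF always_eventually g(4)], rule allI)
      fix n
      have "(\<integral>z. ?I z * Q.avg ?F n z \<partial>(N \<Otimes>\<^sub>M N)) - (\<integral>z. ?I z * g z \<partial>(N \<Otimes>\<^sub>M N))
          = (\<integral>z. ?I z * Q.avg ?F n z - ?I z * g z \<partial>(N \<Otimes>\<^sub>M N))"
        by (rule Bochner_Integration.integral_diff[OF iF ig, symmetric])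
      also have "norm \<dots> \<le> (\<integral>z. norm (?I z * Q.avg ?F n z - ?I z * g z) \<partial>(N \<Otimes>\<^sub>M N))"
        by (rule integral_norm_bound)
      also have "\<dots> \<le> (\<integral>z. \<bar>Q.avg ?F n z - g z\<bar> \<partial>(N \<Otimes>\<^sub>M N))"
        by (rule integral_mono) (use iF ig Q.integrable_avg[OF F] g(1) in \<open>auto simp: indicator_def\<close>)
      finally show "norm ((\<integral>z. ?I z * Q.avg ?F n z \<partial>(N \<Otimes>\<^sub>M N)) - (\<integral>z. ?I z * g z \<partial>(N \<Otimes>\<^sub>M N)))
          \<le> (\<integral>z. \<bar>Q.avg ?F n z - g z\<bar> \<partial>(N \<Otimes>\<^sub>M N))" .
    qed
    then have lim: "(\<lambda>n. (\<integral>z. ?I z * Q.avg ?F n z \<partial>(N \<Otimes>\<^sub>M N)) / measure N P)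
        \<longlonglongrightarrow> (\<integral>z. ?I z * g z \<partial>(N \<Otimes>\<^sub>M N)) / measure N P"
      unfolding divide_inverse by (rule tendsto_mult_right)
    have "(\<integral>z. ?I z * Q.avg ?F n z \<partial>(N \<Otimes>\<^sub>M N)) / measure N P
        = (1 / real n) * (\<Sum>i<n. osc P (\<lambda>x. f ((S ^^ i) x)))" for n
    proof -
      have "?I z * Q.avg ?F n z = (\<Sum>i<n. (1 / real n) * (?I z * cmod (f ((S ^^ i) (fst z)) - f ((S ^^ i) (snd z)))))" for z
        unfolding avg by (simp add: sum_distrib_left mult_ac)
      then have "(\<integral>z. ?I z * Q.avg ?F n z \<partial>(N \<Otimes>\<^sub>M N))
          = (\<Sum>i<n. (1 / real n) * (\<integral>z. ?I z * cmod (f ((S ^^ i) (fst z)) - f ((S ^^ i) (snd z))) \<partial>(N \<Otimes>\<^sub>M N)))"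
        by (simp only:, subst Bochner_Integration.integral_sum)
          (auto intro!: integrable_square_times P integrable_dist_product[OF integrable_iter[OF f]])
      then show ?thesis
        by (simp add: osc_def sum_distrib_left sum_divide_distrib)
    qed
    with lim show "(\<lambda>n. (1 / real n) * (\<Sum>i<n. osc P (\<lambda>x. f ((S ^^ i) x)))) \<longlonglongrightarrow>
      (\<integral>z. indicator (P \<times> P) z * g z \<partial>(N \<Otimes>\<^sub>M N)) / measure N P" by (simp only:)
  qed
qed

end

section \<open>Total boundedness implies mean equicontinuity\<close>

lemma (in prob_space) integrable_simple_approx:
  fixes h :: "'a \<Rightarrow> complex"
  assumes h: "integrable M h" and r: "0 < r"
  obtains s where "simple_function M s" "integrable M s" "(\<integral>x. cmod (h x - s x) \<partial>M) < r"
proof -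
  obtain s where s: "\<And>i. simple_function M (s i)" "\<And>x. x \<in> space M \<Longrightarrow> (\<lambda>i. s i x) \<longlonglongrightarrow> h x"
    "\<And>i x. x \<in> space M \<Longrightarrow> cmod (s i x) \<le> 2 * cmod (h x)"
    using integrable_implies_simple_function_sequence[OF h] by metis
  have [measurable]: "s i \<in> borel_measurable M" for i
    using s(1) by (rule borel_measurable_simple_function)
  have [measurable]: "h \<in> borel_measurable M" using h by auto
  have int: "integrable M (s i)" for i
    by (rule Bochner_Integration.integrable_bound[of _ "\<lambda>x. 2 * cmod (h x)"]) (use h s(3) in auto)
  have "(\<lambda>i. \<integral>x. cmod (h x - s i x) \<partial>M) \<longlonglongrightarrow> (\<integral>x. 0 \<partial>M)"
  proof (rule integral_dominated_convergence)
    show "integrable M (\<lambda>x. 3 * cmod (h x))" using h by simp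
    show "AE x in M. (\<lambda>i. cmod (h x - s i x)) \<longlonglongrightarrow> 0"
    proof (rule AE_I2)
      fix x assume "x \<in> space M"
      then have "(\<lambda>i. cmod (h x - s i x)) \<longlonglongrightarrow> cmod (h x - h x)"
        by (intro tendsto_intros s(2))
      then show "(\<lambda>i. cmod (h x - s i x)) \<longlonglongrightarrow> 0" by simp
    qed
    show "AE x in M. norm (cmod (h x - s i x)) \<le> 3 * cmod (h x)" for i
    proof (rule AE_I2)
      fix x assume "x \<in> space M"
      then show "norm (cmod (h x - s i x)) \<le> 3 * cmod (h x)"
        using s(3)[of x i] norm_triangle_ineq4[of "h x" "s i x"] by simp
    qed
  qed auto
  then have "eventually (\<lambda>i. (\<integral>x. cmod (h x - s i x) \<partial>M) < r) sequentially"
    using r by (intro order_tendstoD) auto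
  then obtain i where "(\<integral>x. cmod (h x - s i x) \<partial>M) < r"
    by (meson eventually_happens' sequentially_bot)
  with s(1) int show thesis by (intro that)
qed

context measure_preserving
begin

text \<open>If every section over \<open>P\<close> were larger than the average, integrating over
  \<open>P\<close> would exceed the measure of \<open>B\<close>. In the proof the integrand
  \<open>?\<psi>\<close> is positive on \<open>P\<close> but has integral at most 0, so
  \<open>P\<close> would be a null set.\<close>

lemma exists_small_section:
  assumes B [measurable]: "B \<in> sets (N \<Otimes>\<^sub>M N)" and P [measurable]: "P \<in> sets N" and pos: "0 < measure N P"
  obtains x where "x \<in> P" "measure N P * measure N (Pair x -` B) \<le> measure (N \<Otimes>\<^sub>M N) B"
proof (rule ccontr)
  note found = that
  let ?\<phi> = "\<lambda>x. measure N (Pair x -` B)" and ?m = "measure (N \<Otimes>\<^sub>M N) B" and ?\<mu> = "measure N P"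
  assume "\<not> thesis"
  then have less: "?m < ?\<mu> * ?\<phi> x" if "x \<in> P" for x
    using found[OF that] by (metis not_le)
  have ind: "integrable (N \<Otimes>\<^sub>M N) (indicat_real B)"
    by (rule integrable_real_indicator[OF B]) (simp add: P.P.emeasure_eq_measure)
  have sec: "(\<integral>y. indicator B (x, y) \<partial>N) = ?\<phi> x" for x
  proof -
    have "(\<integral>y. indicator B (x, y) \<partial>N) = (\<integral>y. indicat_real (Pair x -` B) y \<partial>N)"
      by (rule Bochner_Integration.integral_cong) (auto simp: indicator_def)
    also have "\<dots> = ?\<phi> x" using sets_Pair1[OF B, of x] sets.sets_into_space[OF sets_Pair1[OF B, of x]]
      by (simp add: Int_absorb2)
    finally show ?thesis .
  qed
  have \<phi>: "integrable N ?\<phi>" "(\<integral>x. ?\<phi> x \<partial>N) = ?m"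
    using P.integrable_fst'[OF ind] P.integral_fst'[OF ind] sets.sets_into_space[OF B]
    by (simp_all add: sec Int_absorb2)
  let ?\<psi> = "\<lambda>x. indicator P x * (?\<mu> * ?\<phi> x - ?m)"
  have iP: "integrable N (indicat_real P)"
    by (rule integrable_real_indicator[OF P]) (simp add: emeasure_eq_measure)
  have i: "integrable N (\<lambda>x. indicator P x * ?\<phi> x)" by (rule integrable_indicator_times[OF P \<phi>(1)])
  have eq: "?\<psi> = (\<lambda>x. ?\<mu> * (indicator P x * ?\<phi> x) - indicator P x * ?m)"
    by (auto simp: algebra_simps)
  have int: "integrable N ?\<psi>" unfolding eq using i iP by simp
  have "(\<integral>x. ?\<psi> x \<partial>N) = ?\<mu> * (\<integral>x. indicator P x * ?\<phi> x \<partial>N) - ?\<mu> * ?m"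
    unfolding eq using i iP by (simp add: sets.Int_space_eq2)
  also have "\<dots> \<le> 0"
  proof -
    have "(\<integral>x. indicator P x * ?\<phi> x \<partial>N) \<le> ?m"
      unfolding \<phi>(2)[symmetric] by (rule integral_mono[OF i \<phi>(1)]) (simp add: indicator_def)
    then show ?thesis by (simp add: mult_left_mono)
  qed
  finally have le: "(\<integral>x. ?\<psi> x \<partial>N) \<le> 0" .
  have nn: "AE x in N. 0 \<le> ?\<psi> x" using less by (intro AE_I2) (auto simp: indicator_def less_imp_le)
  with le have "(\<integral>x. ?\<psi> x \<partial>N) = 0" using integral_nonneg_AE by fastforce
  with integral_nonneg_eq_0_iff_AE[OF int nn] have "AE x in N. ?\<psi> x = 0" by simp
  then have ae: "AE x in N. x \<notin> P"
    by eventually_elim (use less in \<open>force simp: indicator_def\<close>)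
  have eq: "{x \<in> space N. \<not> x \<notin> P} = P" using sets.sets_into_space[OF P] by auto
  have "emeasure N P = 0" by (rule iffD1[OF AE_iff_measurable[OF P eq] ae])
  with pos show False by (simp add: measure_def)
qed

text \<open>The cells are the joint level sets of simple functions that approximate a finite net of the orbit;
  on them all \<open>f \<circ> S ^^ i\<close> oscillate little, so the mean distance is small on most of each square.
  Fubini then provides a centre in each cell.\<close>

theorem small_mean_dist_partition:
  assumes f: "integrable N f" and \<epsilon>: "0 < \<epsilon>" and \<tau>: "0 < \<tau>"
    and tot: "\<And>r. 0 < r \<Longrightarrow> \<exists>G. finite G \<and> (\<forall>h\<in>G. integrable N h) \<and>
      (\<forall>i. \<exists>h\<in>G. (\<integral>x. cmod (f ((S ^^ i) x) - h x) \<partial>N) < r)"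
  obtains I :: "(('a \<Rightarrow> complex) \<Rightarrow> complex) set" and Q where "finite I" "disjoint_family_on Q I"
    "\<And>v. v \<in> I \<Longrightarrow> Q v \<in> sets N" "measure N (space N - (\<Union>v\<in>I. Q v)) < \<tau>"
    "\<And>v x y. v \<in> I \<Longrightarrow> x \<in> Q v \<Longrightarrow> y \<in> Q v \<Longrightarrow> mean_dist f x y < ereal \<epsilon>"
proof -
  have [measurable]: "f \<in> borel_measurable N" using f by auto
  \<comment> \<open>Each of the two approximations costs \<open>r\<close> and \<open>osc_le\<close>
    doubles the sum, so the oscillations total at most \<open>4 * r\<close>. Chebyshev at level
    \<open>\<epsilon> / 2\<close> then discards measure at most
    \<open>8 * r / \<epsilon> = \<tau> / 2\<close>.\<close>
  define r where "r = \<epsilon> * \<tau> / 16"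
  have r: "0 < r" using \<epsilon> \<tau> by (simp add: r_def)
  obtain G where G: "finite G" "\<And>h. h \<in> G \<Longrightarrow> integrable N h"
    "\<And>i. \<exists>h\<in>G. (\<integral>x. cmod (f ((S ^^ i) x) - h x) \<partial>N) < r" using tot[OF r] by blast
  have "\<forall>h\<in>G. \<exists>s. simple_function N s \<and> integrable N s \<and> (\<integral>x. cmod (h x - s x) \<partial>N) < r"
    using integrable_simple_approx[OF G(2) r] by metis
  then obtain s where s: "\<And>h. h \<in> G \<Longrightarrow> simple_function N (s h)" "\<And>h. h \<in> G \<Longrightarrow> integrable N (s h)"
    "\<And>h. h \<in> G \<Longrightarrow> (\<integral>x. cmod (h x - s h x) \<partial>N) < r" by metis
  \<comment> \<open>Labels are the attained value vectors, finitely many because each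
    \<open>s h\<close> is simple. Restricting them to \<open>G\<close> makes them extensional, so
    distinct labels have disjoint cells.\<close>
  define V where "V = (\<lambda>x. \<lambda>h\<in>G. s h x) ` space N"
  define P where "P v = {x \<in> space N. \<forall>h\<in>G. s h x = v h}" for v
  have V: "finite V"
  proof (rule finite_subset)
    show "V \<subseteq> (\<Pi>\<^sub>E h\<in>G. s h ` space N)" unfolding V_def by auto
    show "finite (\<Pi>\<^sub>E h\<in>G. s h ` space N)"
      using G(1) s(1) by (intro finite_PiE) (auto simp: simple_function_def)
  qed
  have P [measurable]: "P v \<in> sets N" for v
  proof -
    have "{x \<in> space N. s h x = v h} \<in> sets N" if "h \<in> G" for h
      using borel_measurable_simple_function[OF s(1)[OF that]] by measurable
    then show ?thesis unfolding P_def by (intro sets.sets_Collect_finite_All G(1)) auto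
  qed
  have P_disj: "v = w" if "x \<in> P v" "x \<in> P w" "v \<in> V" "w \<in> V" for v w x
  proof -
    have "v \<in> extensional G" "w \<in> extensional G" using that(3,4) by (auto simp: V_def)
    then show ?thesis by (rule extensionalityI) (use that(1,2) in \<open>auto simp: P_def\<close>)
  qed
  have P_cover: "\<exists>v\<in>V. x \<in> P v" if "x \<in> space N" for x
    by (rule bexI[of _ "\<lambda>h\<in>G. s h x"]) (use that in \<open>auto simp: P_def V_def\<close>)
  have sum_ind: "(\<Sum>v\<in>V. indicator (P v) x * c) = c" if x: "x \<in> space N" for x and c :: real
  proof -
    obtain v where v: "v \<in> V" "x \<in> P v" using P_cover[OF x] by blast
    have "indicator (P w) x * c = (if w = v then c else 0)" if "w \<in> V" for w
    proof (cases "w = v")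
      case False
      then have "x \<notin> P w" using P_disj[OF v(2) _ v(1) that] by metis
      with False show ?thesis by simp
    qed (use v in simp)
    then have "(\<Sum>w\<in>V. indicator (P w) x * c) = (\<Sum>w\<in>V. if w = v then c else 0)" by (rule sum.cong[OF refl])
    with v V show ?thesis by simp
  qed

  obtain g where g: "integrable (N \<Otimes>\<^sub>M N) g" "\<And>z. 0 \<le> g z"
    "AE z in N \<Otimes>\<^sub>M N. mean_dist f (fst z) (snd z) = ereal (g z)"
    "\<And>P. P \<in> sets N \<Longrightarrow> (\<lambda>n. (1 / real n) * (\<Sum>i<n. osc P (\<lambda>x. f ((S ^^ i) x)))) \<longlonglongrightarrow>
      (\<integral>z. indicator (P \<times> P) z * g z \<partial>(N \<Otimes>\<^sub>M N)) / measure N P"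
    by (rule product_birkhoff[OF f]) blast
  define c where "c v = (\<integral>z. indicator (P v \<times> P v) z * g z \<partial>(N \<Otimes>\<^sub>M N)) / measure N (P v)" for v

  \<comment> \<open>On the cell \<open>P v\<close> the function \<open>s h\<close> is the constant
    \<open>v h\<close>, the natural choice of \<open>c\<close> in \<open>osc_le\<close>. The bound
    is uniform in \<open>i\<close>, so it survives averaging and the limit.\<close>
  have osc_sum: "(\<Sum>v\<in>V. osc (P v) (\<lambda>x. f ((S ^^ i) x))) \<le> 4 * r" for i
  proof -
    let ?f = "\<lambda>x. f ((S ^^ i) x)"
    obtain h where h: "h \<in> G" "(\<integral>x. cmod (?f x - h x) \<partial>N) < r" using G(3) by blast
    have fi: "integrable N ?f" by (rule integrable_iter[OF f])
    have int: "integrable N (\<lambda>x. cmod (?f x - s h x))" using fi s(2)[OF h(1)] by simp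
    have "(\<Sum>v\<in>V. osc (P v) ?f) \<le> (\<Sum>v\<in>V. 2 * (\<integral>x. indicator (P v) x * cmod (?f x - s h x) \<partial>N))"
    proof (rule sum_mono)
      fix v
      have "osc (P v) ?f \<le> 2 * (\<integral>x. indicator (P v) x * cmod (?f x - v h) \<partial>N)"
        by (rule osc_le[OF P fi])
      also have "(\<integral>x. indicator (P v) x * cmod (?f x - v h) \<partial>N) = (\<integral>x. indicator (P v) x * cmod (?f x - s h x) \<partial>N)"
      proof (rule Bochner_Integration.integral_cong[OF refl])
        have "s h x = v h" if "x \<in> P v" for x using that h(1) by (simp add: P_def)
        then show "indicator (P v) x * cmod (?f x - v h) = indicator (P v) x * cmod (?f x - s h x)" for x
          by (simp add: indicator_def)
      qed
      finally show "osc (P v) ?f \<le> 2 * (\<integral>x. indicator (P v) x * cmod (?f x - s h x) \<partial>N)" .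
    qed
    also have "\<dots> = 2 * (\<integral>x. (\<Sum>v\<in>V. indicator (P v) x * cmod (?f x - s h x)) \<partial>N)"
      by (subst Bochner_Integration.integral_sum)
        (auto simp: sum_distrib_left intro!: integrable_indicator_times int)
    also have "(\<integral>x. (\<Sum>v\<in>V. indicator (P v) x * cmod (?f x - s h x)) \<partial>N) = (\<integral>x. cmod (?f x - s h x) \<partial>N)"
      by (rule Bochner_Integration.integral_cong) (auto simp: sum_ind)
    also have "\<dots> \<le> (\<integral>x. cmod (?f x - h x) + cmod (h x - s h x) \<partial>N)"
    proof (rule integral_mono[OF int])
      show "integrable N (\<lambda>x. cmod (?f x - h x) + cmod (h x - s h x))"
        using fi s(2)[OF h(1)] G(2)[OF h(1)] by simp
      show "cmod (?f x - s h x) \<le> cmod (?f x - h x) + cmod (h x - s h x)" for x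
        using norm_triangle_ineq[of "?f x - h x" "h x - s h x"] by simp
    qed
    also have "\<dots> = (\<integral>x. cmod (?f x - h x) \<partial>N) + (\<integral>x. cmod (h x - s h x) \<partial>N)"
      using fi s(2)[OF h(1)] G(2)[OF h(1)] by simp
    also have "\<dots> \<le> 2 * r" using h(2) s(3)[OF h(1)] by simp
    finally show ?thesis by simp
  qed
  have c_sum: "(\<Sum>v\<in>V. c v) \<le> 4 * r"
  proof (rule LIMSEQ_le_const2)
    show "(\<lambda>n. \<Sum>v\<in>V. (1 / real n) * (\<Sum>i<n. osc (P v) (\<lambda>x. f ((S ^^ i) x)))) \<longlonglongrightarrow> (\<Sum>v\<in>V. c v)"
      unfolding c_def by (intro tendsto_sum g(4) P)
    have "(\<Sum>v\<in>V. (1 / real n) * (\<Sum>i<n. osc (P v) (\<lambda>x. f ((S ^^ i) x)))) \<le> 4 * r" if "n \<ge> 1" for n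
    proof -
      have "(\<Sum>v\<in>V. (1 / real n) * (\<Sum>i<n. osc (P v) (\<lambda>x. f ((S ^^ i) x))))
          = (1 / real n) * (\<Sum>i<n. \<Sum>v\<in>V. osc (P v) (\<lambda>x. f ((S ^^ i) x)))"
        by (subst sum.swap) (simp add: sum_distrib_left)
      also have "\<dots> \<le> (1 / real n) * (\<Sum>i<n. 4 * r)"
        by (intro mult_left_mono sum_mono osc_sum) auto
      also have "\<dots> = 4 * r" using that by simp
      finally show ?thesis .
    qed
    then show "\<exists>n0. \<forall>n\<ge>n0. (\<Sum>v\<in>V. (1 / real n) * (\<Sum>i<n. osc (P v) (\<lambda>x. f ((S ^^ i) x)))) \<le> 4 * r"
      by blast
  qed

  note [measurable] = mean_dist_measurable[of f]
  have "\<exists>Q. Q \<in> sets N \<and> Q \<subseteq> P v \<and> measure N (P v - Q) \<le> (2 / \<epsilon>) * c v \<and>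
      (\<forall>x\<in>Q. \<forall>y\<in>Q. mean_dist f x y < ereal \<epsilon>)" for v
  proof (cases "measure N (P v) = 0")
    case True
    then show ?thesis by (intro exI[of _ "{}"]) (simp add: c_def)
  next
    case False
    then have pos: "measure N (P v) > 0" by (simp add: less_le)
    \<comment> \<open>The bad pairs are defined by \<open>mean_dist\<close> and not by
      \<open>g\<close>, so every pair of the square outside \<open>B\<close> is good without
      exception. The level is \<open>\<epsilon> / 2\<close> because two points are compared through
      a centre.\<close>
    define B where "B = {z \<in> space (N \<Otimes>\<^sub>M N). z \<in> P v \<times> P v \<and> \<not> mean_dist f (fst z) (snd z) < ereal (\<epsilon> / 2)}"
    have [measurable]: "P v \<times> P v \<in> sets (N \<Otimes>\<^sub>M N)" by simp
    have B [measurable]: "B \<in> sets (N \<Otimes>\<^sub>M N)" unfolding B_def by measurable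
    have "(\<epsilon> / 2) * measure (N \<Otimes>\<^sub>M N) B = (\<integral>z. (\<epsilon> / 2) * indicator B z \<partial>(N \<Otimes>\<^sub>M N))"
      using sets.sets_into_space[OF B] by (simp add: Int_absorb2)
    also have "\<dots> \<le> (\<integral>z. indicator (P v \<times> P v) z * g z \<partial>(N \<Otimes>\<^sub>M N))"
    proof (rule integral_mono_AE)
      show "integrable (N \<Otimes>\<^sub>M N) (\<lambda>z. (\<epsilon> / 2) * indicator B z)"
        by (intro integrable_mult_right integrable_real_indicator B) (simp add: P.P.emeasure_eq_measure)
      show "integrable (N \<Otimes>\<^sub>M N) (\<lambda>z. indicator (P v \<times> P v) z * g z)"
        by (intro integrable_square_times P g)
      show "AE z in N \<Otimes>\<^sub>M N. (\<epsilon> / 2) * indicator B z \<le> indicator (P v \<times> P v) z * g z"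
        using g(3) by eventually_elim (use g(2) in \<open>auto simp: B_def indicator_def\<close>)
    qed
    finally have "(\<epsilon> / 2) * measure (N \<Otimes>\<^sub>M N) B / measure N (P v) \<le> c v"
      using pos unfolding c_def by (intro divide_right_mono) auto
    moreover obtain x where x: "x \<in> P v" "measure N (P v) * measure N (Pair x -` B) \<le> measure (N \<Otimes>\<^sub>M N) B"
      using exists_small_section[OF B P pos] .
    ultimately have small: "measure N (Pair x -` B) \<le> (2 / \<epsilon>) * c v"
    proof -
      have "measure N (Pair x -` B) \<le> measure (N \<Otimes>\<^sub>M N) B / measure N (P v)"
        using x(2) pos by (simp add: field_simps)
      also have "\<dots> = (2 / \<epsilon>) * ((\<epsilon> / 2) * measure (N \<Otimes>\<^sub>M N) B / measure N (P v))"
        using \<epsilon> by simp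
      also have "\<dots> \<le> (2 / \<epsilon>) * c v"
        using \<epsilon> \<open>(\<epsilon> / 2) * measure (N \<Otimes>\<^sub>M N) B / measure N (P v) \<le> c v\<close> by (intro mult_left_mono) auto
      finally show ?thesis .
    qed
    define Q where "Q = P v - Pair x -` B"
    have [measurable]: "Pair x -` B \<in> sets N" by (rule sets_Pair1[OF B])
    have "Q \<in> sets N" unfolding Q_def by measurable
    moreover have "Q \<subseteq> P v" unfolding Q_def by auto
    moreover have "P v - Q = Pair x -` B" unfolding Q_def B_def by auto
    moreover have "mean_dist f y z < ereal \<epsilon>" if "y \<in> Q" "z \<in> Q" for y z
    proof -
      have *: "mean_dist f x w < ereal (\<epsilon> / 2)" if "w \<in> Q" for w
        using that x(1) sets.sets_into_space[OF P, of v] by (auto simp: Q_def B_def space_pair_measure)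
      have "mean_dist f y z \<le> mean_dist f x y + mean_dist f x z"
        using mean_dist_triangle[of f y z x] by (simp add: mean_dist_commute)
      also have "\<dots> < ereal (\<epsilon> / 2) + ereal (\<epsilon> / 2)" using *[OF that(1)] *[OF that(2)] by (rule ereal_add_strict_mono2)
      finally show ?thesis by simp
    qed
    ultimately show ?thesis using small by (intro exI[of _ Q]) auto
  qed
  then obtain Q where Q: "\<And>v. Q v \<in> sets N" "\<And>v. Q v \<subseteq> P v" "\<And>v. measure N (P v - Q v) \<le> (2 / \<epsilon>) * c v"
      "\<And>v x y. x \<in> Q v \<Longrightarrow> y \<in> Q v \<Longrightarrow> mean_dist f x y < ereal \<epsilon>" by metis
  show thesis
  proof (rule that[OF V])
    show "disjoint_family_on Q V"
      using Q(2) P_disj unfolding disjoint_family_on_def by blast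
    have "measure N (space N - (\<Union>v\<in>V. Q v)) \<le> measure N (\<Union>v\<in>V. P v - Q v)"
      using P_cover V by (intro finite_measure_mono) (auto intro!: sets.finite_UN Q(1))
    also have "\<dots> \<le> (\<Sum>v\<in>V. measure N (P v - Q v))"
      using V by (intro finite_measure_subadditive_finite) (auto intro: Q(1))
    also have "\<dots> \<le> (\<Sum>v\<in>V. (2 / \<epsilon>) * c v)" by (intro sum_mono Q(3))
    also have "\<dots> \<le> (2 / \<epsilon>) * (4 * r)"
      unfolding sum_distrib_left[symmetric] using \<epsilon> c_sum by (intro mult_left_mono) auto
    also have "\<dots> = \<tau> / 2" using \<epsilon> by (simp add: r_def)
    also have "\<dots> < \<tau>" using \<tau> by simp
    finally show "measure N (space N - (\<Union>v\<in>V. Q v)) < \<tau>" .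
  qed (use Q in auto)
qed

end

text \<open>The measurable cells are replaced by closed subsets, compact in the compact space. Being
  disjoint, these are separated by some \<open>d\<close>, so points closer than \<open>d\<close>
  share a cell.\<close>

lemma compact_small_mean_dist:
  fixes M :: "'a::metric_space measure"
  assumes "measure_preserving M T" and cpt: "compact (UNIV :: 'a set)" and sets: "sets M = sets borel"
    and f: "integrable M f" and \<epsilon>: "0 < \<epsilon>" and \<tau>: "0 < \<tau>"
    and tot: "\<And>r. 0 < r \<Longrightarrow> \<exists>G. finite G \<and> (\<forall>h\<in>G. integrable M h) \<and>
      (\<forall>i. \<exists>h\<in>G. (\<integral>x. cmod (f ((T ^^ i) x) - h x) \<partial>M) < r)"
  obtains K d where "compact K" "measure M (space M - K) < \<tau>" "0 < d"
    "\<And>x y. x \<in> K \<Longrightarrow> y \<in> K \<Longrightarrow> dist x y < d \<Longrightarrow> measure_preserving.mean_dist T f x y < ereal \<epsilon>"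
proof -
  interpret measure_preserving M T by fact
  have "0 < \<tau> / 2" using \<tau> by simp
  from small_mean_dist_partition[OF f \<epsilon> this tot]
  obtain I :: "(('a \<Rightarrow> complex) \<Rightarrow> complex) set" and Q
    where I: "finite I" and disj: "disjoint_family_on Q I" and Q [measurable]: "\<And>v. v \<in> I \<Longrightarrow> Q v \<in> sets M"
      and Q_cover: "measure M (space M - (\<Union>v\<in>I. Q v)) < \<tau> / 2"
      and Q_small: "\<And>v x y. v \<in> I \<Longrightarrow> x \<in> Q v \<Longrightarrow> y \<in> Q v \<Longrightarrow> mean_dist f x y < ereal \<epsilon>"
    by metis
  \<comment> \<open>Half of \<open>\<tau>\<close> is spent on the points outside the cells, the
    other half is divided among the cells; the \<open>+ 1\<close> keeps \<open>t\<close> positive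
    when there are none.\<close>
  define t where "t = \<tau> / (2 * (real (card I) + 1))"
  have t: "0 < t" "real (card I) * t \<le> \<tau> / 2"
    using \<tau> by (auto simp: t_def field_simps)
  have ex: "\<exists>C. closed C \<and> C \<subseteq> Q v \<and> measure M (Q v - C) < t" if v: "v \<in> I" for v
  proof -
    obtain C U where *: "closed C" "open U" "C \<subseteq> Q v" "Q v \<subseteq> U" "measure M (U - C) < t"
      using borel_regular_metric[OF finite_measure_axioms sets Q[OF v] t(1)] .
    have "U - C \<in> sets M" using *(1,2) by (simp add: sets)
    then have "measure M (Q v - C) \<le> measure M (U - C)" using *(4) by (intro finite_measure_mono) auto
    with * show ?thesis by (intro exI[of _ C]) simp
  qed
  define C where "C v = (SOME C. closed C \<and> C \<subseteq> Q v \<and> measure M (Q v - C) < t)" for v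
  have C: "closed (C v)" "C v \<subseteq> Q v" "measure M (Q v - C v) < t" if "v \<in> I" for v
    using someI_ex[OF ex[OF that]] by (simp_all add: C_def)
  have C_cpt: "compact (C v)" if "v \<in> I" for v
    using compact_Int_closed[OF cpt C(1)[OF that]] by simp
  have Cs: "C v \<in> sets M" if "v \<in> I" for v using C(1)[OF that] by (simp add: sets)
  have C_disj: "disjoint_family_on C I"
  proof (rule disjoint_family_on_bisimulation[OF disj])
    fix v w assume "v \<in> I" "w \<in> I" "Q v \<inter> Q w = {}"
    with C(2)[of v] C(2)[of w] show "C v \<inter> C w = {}" by blast
  qed
  obtain d where d: "d > 0" "\<And>i j x y. i \<in> I \<Longrightarrow> j \<in> I \<Longrightarrow> x \<in> C i \<Longrightarrow> y \<in> C j \<Longrightarrow> dist x y < d \<Longrightarrow> i = j"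
    using compact_disjoint_family_separated[OF I C_cpt C_disj] by metis
  show thesis
  proof (rule that[of "\<Union>v\<in>I. C v" d])
    show "compact (\<Union>v\<in>I. C v)" using I C_cpt by (intro compact_UN) auto
    have U: "(\<Union>v\<in>I. Q v) \<in> sets M" "(\<Union>v\<in>I. Q v - C v) \<in> sets M"
      using I Q Cs by (auto intro!: sets.finite_UN)
    have "measure M (space M - (\<Union>v\<in>I. C v)) \<le> measure M ((space M - (\<Union>v\<in>I. Q v)) \<union> (\<Union>v\<in>I. Q v - C v))"
      using U by (intro finite_measure_mono) auto
    also have "\<dots> \<le> measure M (space M - (\<Union>v\<in>I. Q v)) + measure M (\<Union>v\<in>I. Q v - C v)"
      using U by (intro measure_Un_le) auto
    also have "measure M (\<Union>v\<in>I. Q v - C v) \<le> (\<Sum>v\<in>I. measure M (Q v - C v))"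
      using I Q Cs by (intro finite_measure_subadditive_finite) auto
    also have "\<dots> \<le> real (card I) * t"
      by (rule sum_bounded_above) (simp add: C(3) less_imp_le)
    finally show "measure M (space M - (\<Union>v\<in>I. C v)) < \<tau>" using Q_cover t(2) by linarith
    show "mean_dist f x y < ereal \<epsilon>" if xy: "x \<in> (\<Union>v\<in>I. C v)" "y \<in> (\<Union>v\<in>I. C v)" "dist x y < d" for x y
    proof -
      obtain v w where vw: "v \<in> I" "x \<in> C v" "w \<in> I" "y \<in> C w" using xy(1,2) by auto
      have "v = w" by (rule d(2)[OF vw(1,3,2,4) xy(3)])
      with vw C(2)[OF vw(1)] show ?thesis by (intro Q_small[of v]) auto
    qed
  qed (fact d(1))
qed

text \<open>The compact set has to be chosen before \<epsilon>. It is the intersection of sets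
  \<open>K m\<close> that serve the tolerances \<open>inverse (real (Suc m))\<close>, with losses of
  measure summing to at most \<open>\<tau> / 2\<close>.\<close>

theorem mean_equicontinuous_if_orbit_totally_bounded:
  fixes M :: "'a::metric_space measure"
  assumes "measure_preserving M T" and cpt: "compact (UNIV :: 'a set)" and sets: "sets M = sets borel"
    and f: "integrable M f"
    and tot: "\<And>r. 0 < r \<Longrightarrow> \<exists>G. finite G \<and> (\<forall>h\<in>G. integrable M h) \<and>
      (\<forall>i. \<exists>h\<in>G. (\<integral>x. cmod (f ((T ^^ i) x) - h x) \<partial>M) < r)"
  shows "mean_equicontinuous M T f"
  unfolding mean_equicontinuous_def
proof (intro allI impI)
  interpret measure_preserving M T by fact
  fix \<tau> :: real assume \<tau>: "\<tau> > 0"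
  have "\<exists>K d. compact K \<and> measure M (space M - K) < \<tau> / 2 * (1/2) ^ Suc m \<and> 0 < d \<and>
    (\<forall>x\<in>K. \<forall>y\<in>K. dist x y < d \<longrightarrow> mean_dist f x y < ereal (inverse (real (Suc m))))" for m
  proof -
    have "0 < inverse (real (Suc m))" "0 < \<tau> / 2 * (1/2) ^ Suc m" using \<tau> by simp_all
    from compact_small_mean_dist[OF assms(1) cpt sets f this tot] show ?thesis by metis
  qed
  then obtain K d where K: "\<And>m. compact (K m)" "\<And>m. measure M (space M - K m) < \<tau> / 2 * (1/2) ^ Suc m"
    "\<And>m. 0 < d m" "\<And>m x y. x \<in> K m \<Longrightarrow> y \<in> K m \<Longrightarrow> dist x y < d m \<Longrightarrow>
      mean_dist f x y < ereal (inverse (real (Suc m)))" by metis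
  have Ks: "K m \<in> sets M" for m using compact_imp_closed[OF K(1)] by (simp add: sets)
  have cl: "closed (\<Inter>m. K m)" using compact_imp_closed[OF K(1)] by (intro closed_INT) auto
  have gs: "(\<lambda>n. \<tau> / 2 * (1/2)^Suc n) sums (\<tau> / 2)"
    using sums_mult[OF power_half_series, of "\<tau> / 2"] by simp
  have sm: "summable (\<lambda>n. measure M (space M - K n))"
    by (rule summable_comparison_test'[OF sums_summable[OF gs]]) (use K(2) in \<open>auto intro: less_imp_le\<close>)
  have "1 - measure M (\<Inter>m. K m) = measure M (space M - (\<Inter>m. K m))"
    using cl by (intro prob_compl[symmetric]) (simp add: sets)
  also have "space M - (\<Inter>m. K m) = (\<Union>m. space M - K m)" by auto
  also have "measure M \<dots> \<le> (\<Sum>m. measure M (space M - K m))"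
    using Ks by (intro finite_measure_subadditive_countably sm) auto
  also have "\<dots> \<le> (\<Sum>m. \<tau> / 2 * (1/2) ^ Suc m)"
    using K(2) by (intro suminf_le sm sums_summable[OF gs]) (auto intro: less_imp_le)
  also have "\<dots> = \<tau> / 2" using gs by (simp add: sums_iff)
  finally have "measure M (\<Inter>m. K m) > 1 - \<tau>" using \<tau> by simp
  moreover have "compact (\<Inter>m. K m)" using compact_Int_closed[OF cpt cl] by simp
  moreover have "\<exists>\<delta>>0. \<forall>x\<in>(\<Inter>m. K m). \<forall>y\<in>(\<Inter>m. K m). dist x y < \<delta> \<longrightarrow> mean_dist f x y < ereal \<epsilon>"
    if pos: "\<epsilon> > 0" for \<epsilon>
  proof -
    obtain m where m: "inverse (real (Suc m)) < \<epsilon>" using reals_Archimedean[OF pos] by blast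
    have "mean_dist f x y < ereal \<epsilon>" if "x \<in> (\<Inter>m. K m)" "y \<in> (\<Inter>m. K m)" "dist x y < d m" for x y
    proof -
      have "mean_dist f x y < ereal (inverse (real (Suc m)))" using that by (intro K(4)) auto
      also have "\<dots> < ereal \<epsilon>" using m by simp
      finally show ?thesis .
    qed
    with K(3)[of m] show ?thesis by blast
  qed
  ultimately show "\<exists>K. compact K \<and> 1 - \<tau> < measure M K \<and> (\<forall>\<epsilon>>0. \<exists>\<delta>>0. \<forall>x\<in>K. \<forall>y\<in>K. dist x y < \<delta> \<longrightarrow>
      limsup (\<lambda>n. ereal ((1 / real n) * (\<Sum>i<n. cmod (f ((T ^^ i) x) - f ((T ^^ i) y))))) < ereal \<epsilon>)"
    unfolding mean_dist_def by (intro exI[of _ "\<Inter>m. K m"] conjI allI impI)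
qed

text \<open>Uniform integrability of the orbit: its members are identically distributed, so one
  cutoff \<open>C\<close> makes all their tails small. It later controls the orbit outside the
  compact set of mean equicontinuity.\<close>

lemma (in measure_preserving) orbit_uniformly_small:
  assumes f: "integrable N f" and s: "0 < s"
  obtains \<tau> where "0 < \<tau>"
    "\<And>A i. A \<in> sets N \<Longrightarrow> measure N A < \<tau> \<Longrightarrow> (\<integral>x. indicator A x * cmod (f ((S ^^ i) x)) \<partial>N) < s"
proof -
  have [measurable]: "f \<in> borel_measurable N" using f by auto
  define \<psi> where "\<psi> C a = (if cmod a > C then cmod a else 0)" for C :: real and a
  have [measurable]: "\<psi> C \<in> borel_measurable borel" for C unfolding \<psi>_def by measurable
  have \<psi>_le: "\<bar>\<psi> C a\<bar> \<le> cmod a" for C a by (simp add: \<psi>_def)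
  have "(\<lambda>n. \<integral>x. \<psi> (real n) (f x) \<partial>N) \<longlonglongrightarrow> (\<integral>x. 0 \<partial>N)"
  proof (rule integral_dominated_convergence)
    show "integrable N (\<lambda>x. cmod (f x))" using f by simp
    show "AE x in N. (\<lambda>n. \<psi> (real n) (f x)) \<longlonglongrightarrow> 0"
    proof (rule AE_I2)
      fix x
      obtain k where "cmod (f x) \<le> real k" using real_arch_simple by blast
      then have "\<forall>\<^sub>F n in sequentially. \<psi> (real n) (f x) = 0"
        by (intro eventually_sequentiallyI[of k]) (auto simp: \<psi>_def)
      then show "(\<lambda>n. \<psi> (real n) (f x)) \<longlonglongrightarrow> 0" by (rule tendsto_eventually)
    qed
  qed (use \<psi>_le in auto)
  then have "\<forall>\<^sub>F n in sequentially. (\<integral>x. \<psi> (real n) (f x) \<partial>N) < s / 2"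
    using s by (intro order_tendstoD) auto
  from eventually_happens'[OF sequentially_bot eventually_conj[OF this eventually_ge_at_top[of 1]]]
  obtain n where n: "n \<ge> 1" "(\<integral>x. \<psi> (real n) (f x) \<partial>N) < s / 2" by (elim exE conjE)
  define C where "C = real n"
  have C: "C > 0" "(\<integral>x. \<psi> C (f x) \<partial>N) < s / 2" using n by (auto simp: C_def)
  show thesis
  proof (rule that[of "s / (2 * C)"])
    show "0 < s / (2 * C)" using s C by simp
    fix A i assume A [measurable]: "A \<in> sets N" and small: "measure N A < s / (2 * C)"
    let ?h = "\<lambda>x. f ((S ^^ i) x)"
    have i\<psi>: "integrable N (\<lambda>x. \<psi> C (?h x))"
      by (rule Bochner_Integration.integrable_bound[OF integrable_iter[OF f, of i]]) (use \<psi>_le in auto)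
    have iA: "integrable N (indicat_real A)"
      by (rule integrable_real_indicator[OF A]) (simp add: emeasure_eq_measure)
    have "(\<integral>x. indicator A x * cmod (?h x) \<partial>N) \<le> (\<integral>x. C * indicator A x + \<psi> C (?h x) \<partial>N)"
    proof (rule integral_mono)
      show "integrable N (\<lambda>x. indicator A x * cmod (?h x))"
        by (intro integrable_indicator_times A integrable_norm integrable_iter f)
      show "integrable N (\<lambda>x. C * indicator A x + \<psi> C (?h x))" using iA i\<psi> by simp
      show "indicator A x * cmod (?h x) \<le> C * indicator A x + \<psi> C (?h x)" for x
        using C by (auto simp: indicator_def \<psi>_def)
    qed
    also have "\<dots> = C * measure N A + (\<integral>x. \<psi> C (?h x) \<partial>N)"
      using iA i\<psi> by (simp add: sets.Int_space_eq2)
    also have "(\<integral>x. \<psi> C (?h x) \<partial>N) = (\<integral>x. \<psi> C (f x) \<partial>N)"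
      by (rule integral_iter) measurable
    also have "C * measure N A + \<dots> < s"
    proof -
      have "C * measure N A < C * (s / (2 * C))" using small C by (intro mult_strict_left_mono) auto
      with C show ?thesis by simp
    qed
    finally show "(\<integral>x. indicator A x * cmod (?h x) \<partial>N) < s" .
  qed
qed

section \<open>Mean equicontinuity implies total boundedness\<close>

text \<open>\<open>R\<close> collects the times at which the total oscillation over the cells is small, and \<open>\<kappa>\<close> rounds
  the vector of the integrals of \<open>f \<circ> S ^^ i\<close> over the cells to a finite net.\<close>

lemma (in measure_preserving) orbit_classification:
  fixes I :: "'i set"
  assumes f: "integrable N f" and r: "0 < r" and I: "finite I"
    and P [measurable]: "\<And>k. k \<in> I \<Longrightarrow> P k \<in> sets N" and disj: "disjoint_family_on P I"
    and small: "\<And>k x y. k \<in> I \<Longrightarrow> x \<in> P k \<Longrightarrow> y \<in> P k \<Longrightarrow> mean_dist f x y < ereal (r / 128)"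
    and rest: "\<And>i. (\<integral>x. indicator (space N - (\<Union>k\<in>I. P k)) x * cmod (f ((S ^^ i) x)) \<partial>N) < r / 8"
  obtains \<kappa> :: "nat \<Rightarrow> 'i \<Rightarrow> complex" and R :: "nat set" and n0 where "finite (range \<kappa>)"
    "\<And>i j. i \<in> R \<Longrightarrow> j \<in> R \<Longrightarrow> \<kappa> i = \<kappa> j \<Longrightarrow> (\<integral>x. cmod (f ((S ^^ i) x) - f ((S ^^ j) x)) \<partial>N) < r"
    "\<And>n. n0 \<le> n \<Longrightarrow> 8 * card ({..<n} - R) \<le> n"
proof -
  define \<epsilon> where "\<epsilon> = r / 128"
  have \<epsilon>: "0 < \<epsilon>" using r by (simp add: \<epsilon>_def)
  define A where "A = space N - (\<Union>k\<in>I. P k)"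
  have A [measurable]: "A \<in> sets N" unfolding A_def using I P by (auto intro!: sets.finite_UN)
  obtain g where g: "integrable (N \<Otimes>\<^sub>M N) g" "\<And>z. 0 \<le> g z"
    "AE z in N \<Otimes>\<^sub>M N. mean_dist f (fst z) (snd z) = ereal (g z)"
    "\<And>P. P \<in> sets N \<Longrightarrow> (\<lambda>n. (1 / real n) * (\<Sum>i<n. osc P (\<lambda>x. f ((S ^^ i) x)))) \<longlonglongrightarrow>
      (\<integral>z. indicator (P \<times> P) z * g z \<partial>(N \<Otimes>\<^sub>M N)) / measure N P"
    by (rule product_birkhoff[OF f]) blast
  define c where "c k = (\<integral>z. indicator (P k \<times> P k) z * g z \<partial>(N \<Otimes>\<^sub>M N)) / measure N (P k)" for k
  \<comment> \<open>The square has measure \<open>measure N (P k)\<close> squared, and one factor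
    cancels with the division in \<open>c\<close>. The bounds therefore sum to at most
    \<open>\<epsilon>\<close> over the disjoint cells.\<close>
  have c_le: "c k \<le> \<epsilon> * measure N (P k)" if k: "k \<in> I" for k
  proof -
    let ?b = "indicat_real (P k)"
    have b: "integrable N ?b"
      by (rule integrable_real_indicator[OF P[OF k]]) (simp add: emeasure_eq_measure)
    have "(\<integral>z. indicator (P k \<times> P k) z * g z \<partial>(N \<Otimes>\<^sub>M N)) \<le> (\<integral>z. \<epsilon> * (?b (fst z) * ?b (snd z)) \<partial>(N \<Otimes>\<^sub>M N))"
    proof (rule integral_mono_AE)
      show "integrable (N \<Otimes>\<^sub>M N) (\<lambda>z. indicator (P k \<times> P k) z * g z)"
        by (intro integrable_square_times P k g)
      show "integrable (N \<Otimes>\<^sub>M N) (\<lambda>z. \<epsilon> * (?b (fst z) * ?b (snd z)))"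
        by (intro integrable_mult_right integrable_product b)
      show "AE z in N \<Otimes>\<^sub>M N. indicator (P k \<times> P k) z * g z \<le> \<epsilon> * (?b (fst z) * ?b (snd z))"
        using g(3)
      proof eventually_elim
        case (elim z)
        show ?case
        proof (cases "z \<in> P k \<times> P k")
          case True
          then have "mean_dist f (fst z) (snd z) < ereal \<epsilon>"
            unfolding \<epsilon>_def by (intro small[OF k]) auto
          with elim True show ?thesis by (auto simp: indicator_def)
        qed (use \<epsilon> in \<open>auto simp: indicator_def\<close>)
      qed
    qed
    also have "\<dots> = \<epsilon> * (measure N (P k))\<^sup>2"
      using integral_product[OF b b] P[OF k] by (simp add: sets.Int_space_eq2 power2_eq_square)
    finally show ?thesis
      unfolding c_def by (cases "measure N (P k) = 0") (simp_all add: divide_le_eq less_le power2_eq_square mult.assoc)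
  qed
  have c_sum: "(\<Sum>k\<in>I. c k) \<le> \<epsilon>"
  proof -
    have "(\<Sum>k\<in>I. c k) \<le> \<epsilon> * (\<Sum>k\<in>I. measure N (P k))"
      unfolding sum_distrib_left by (intro sum_mono c_le)
    also have "(\<Sum>k\<in>I. measure N (P k)) = measure N (\<Union>k\<in>I. P k)"
      using I P disj by (intro finite_measure_finite_Union[symmetric]) auto
    also have "\<epsilon> * \<dots> \<le> \<epsilon> * 1" using \<epsilon> by (intro mult_left_mono) auto
    finally show ?thesis by simp
  qed

  define W where "W i = (\<Sum>k\<in>I. osc (P k) (\<lambda>x. f ((S ^^ i) x)))" for i
  have W_nonneg: "0 \<le> W i" for i unfolding W_def by (intro sum_nonneg osc_nonneg)
  \<comment> \<open>The averages of \<open>W\<close> are eventually below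
    \<open>2 * \<epsilon>\<close>, so by Markov at most an eighth of the times reach
    \<open>16 * \<epsilon>\<close>.\<close>
  define R where "R = {i. W i < 16 * \<epsilon>}"
  have "(\<lambda>n. \<Sum>k\<in>I. (1 / real n) * (\<Sum>i<n. osc (P k) (\<lambda>x. f ((S ^^ i) x)))) \<longlonglongrightarrow> (\<Sum>k\<in>I. c k)"
    unfolding c_def by (intro tendsto_sum g(4) P)
  also have "(\<lambda>n. \<Sum>k\<in>I. (1 / real n) * (\<Sum>i<n. osc (P k) (\<lambda>x. f ((S ^^ i) x)))) = (\<lambda>n. (1 / real n) * (\<Sum>i<n. W i))"
    unfolding W_def by (subst sum.swap) (simp add: sum_distrib_left)
  finally have "eventually (\<lambda>n. (1 / real n) * (\<Sum>i<n. W i) < 2 * \<epsilon>) sequentially"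
    using c_sum \<epsilon> by (intro order_tendstoD(2)) auto
  then obtain n0 where n0: "\<And>n. n0 \<le> n \<Longrightarrow> (1 / real n) * (\<Sum>i<n. W i) < 2 * \<epsilon>"
    unfolding eventually_sequentially by blast
  have density: "8 * card ({..<n} - R) \<le> n" if n: "n0 \<le> n" for n
  proof (cases "n = 0")
    case False
    have "16 * \<epsilon> * real (card ({..<n} - R)) = (\<Sum>i\<in>{..<n} - R. 16 * \<epsilon>)" by simp
    also have "\<dots> \<le> (\<Sum>i\<in>{..<n} - R. W i)" by (intro sum_mono) (auto simp: R_def)
    also have "\<dots> \<le> (\<Sum>i<n. W i)" by (intro sum_mono2 W_nonneg) auto
    also have "\<dots> < 2 * \<epsilon> * real n" using n0[OF n] False by (simp add: divide_less_eq)
    finally have "(2 * \<epsilon>) * (8 * real (card ({..<n} - R))) < (2 * \<epsilon>) * real n" by simp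
    then have "8 * real (card ({..<n} - R)) < real n" using \<epsilon> by simp
    then show ?thesis by linarith
  qed simp

  define a where "a i k = (\<integral>x. indicator (P k) x *\<^sub>R f ((S ^^ i) x) \<partial>N)" for i k
  define B where "B = (\<integral>x. cmod (f x) \<partial>N)"
  define \<eta> where "\<eta> = r / (8 * (real (card I) + 1))"
  have \<eta>: "0 < \<eta>" "real (card I) * (2 * \<eta>) \<le> r / 4"
    using r by (auto simp: \<eta>_def field_simps)
  have a_bound: "a i k \<in> cball 0 B" if k: "k \<in> I" for i k
  proof -
    have "cmod (a i k) \<le> (\<integral>x. cmod (indicator (P k) x *\<^sub>R f ((S ^^ i) x)) \<partial>N)"
      unfolding a_def by (rule integral_norm_bound)
    also have "\<dots> \<le> (\<integral>x. cmod (f ((S ^^ i) x)) \<partial>N)"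
      using integrable_iter[OF f, of i] integrable_indicator_times[OF P[OF k] integrable_norm[OF integrable_iter[OF f]], of i]
      by (intro integral_mono) (auto simp: indicator_def)
    also have "\<dots> = B" unfolding B_def by (rule integral_iter) (use f in auto)
    finally show ?thesis by simp
  qed
  from compact_cball[of "0 :: complex" B, unfolded compact_eq_totally_bounded, THEN conjunct2, rule_format, OF \<eta>(1)]
  obtain Z :: "complex set" where Z: "finite Z" "cball 0 B \<subseteq> (\<Union>z\<in>Z. ball z \<eta>)" by (elim exE conjE)
  define q where "q w = (SOME z. z \<in> Z \<and> dist z w < \<eta>)" for w
  have q: "q w \<in> Z \<and> dist (q w) w < \<eta>" if "w \<in> cball 0 B" for w
  proof -
    from subsetD[OF Z(2) that] obtain z where "z \<in> Z" "w \<in> ball z \<eta>" by (rule UN_E)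
    then have "z \<in> Z \<and> dist z w < \<eta>" by simp
    then show ?thesis unfolding q_def by (rule someI)
  qed
  \<comment> \<open>Restriction to \<open>I\<close> makes the rounded vectors extensional, so there
    are only finitely many of them.\<close>
  define \<kappa> where "\<kappa> i = (\<lambda>k\<in>I. q (a i k))" for i

  show thesis
  proof (rule that[of \<kappa> R n0])
    show "finite (range \<kappa>)"
    proof (rule finite_subset)
      show "range \<kappa> \<subseteq> (\<Pi>\<^sub>E k\<in>I. Z)" using q a_bound by (auto simp: \<kappa>_def)
      show "finite (\<Pi>\<^sub>E k\<in>I. Z)" using I Z(1) by (intro finite_PiE) auto
    qed
    fix i j assume ij: "i \<in> R" "j \<in> R" "\<kappa> i = \<kappa> j"
    let ?h = "\<lambda>x. f ((S ^^ i) x)" and ?k = "\<lambda>x. f ((S ^^ j) x)"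
    have h: "integrable N ?h" and k: "integrable N ?k" by (rule integrable_iter[OF f])+
    have hk: "integrable N (\<lambda>x. cmod (?h x - ?k x))" using h k by simp
    have iA: "integrable N (\<lambda>x. indicator A x * cmod (?h x))" "integrable N (\<lambda>x. indicator A x * cmod (?k x))"
      by (intro integrable_indicator_times A integrable_norm h k)+
    have iP: "integrable N (\<lambda>x. indicator (P l) x * cmod (?h x - ?k x))" if "l \<in> I" for l
      by (intro integrable_indicator_times P hk that)
    have ind: "1 = indicator A x + (\<Sum>l\<in>I. indicat_real (P l) x)" if x: "x \<in> space N" for x
    proof -
      have "indicat_real (\<Union>l\<in>I. P l) x = (\<Sum>l\<in>I. indicator (P l) x)"
        by (rule indicator_UN_disjoint[OF I disj])
      moreover have "1 = indicator A x + indicat_real (\<Union>l\<in>I. P l) x"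
        using x by (simp add: A_def indicator_def)
      ultimately show ?thesis by (simp only:)
    qed
    \<comment> \<open>The budget: less than \<open>r / 8\<close> off the cells for each function,
      less than \<open>32 * \<epsilon> = r / 4\<close> from the two values of \<open>W\<close>, and
      at most \<open>r / 4\<close> from rounding. This is the origin of
      \<open>r / 128\<close>.\<close>
    have "(\<integral>x. cmod (?h x - ?k x) \<partial>N) \<le> (\<integral>x. indicator A x * cmod (?h x) + indicator A x * cmod (?k x)
        + (\<Sum>l\<in>I. indicator (P l) x * cmod (?h x - ?k x)) \<partial>N)"
    proof (rule integral_mono[OF hk])
      show "integrable N (\<lambda>x. indicator A x * cmod (?h x) + indicator A x * cmod (?k x)
        + (\<Sum>l\<in>I. indicator (P l) x * cmod (?h x - ?k x)))"
        by (intro Bochner_Integration.integrable_add Bochner_Integration.integrable_sum iA iP)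
      fix x assume "x \<in> space N"
      from ind[OF this] have "cmod (?h x - ?k x) = (indicator A x + (\<Sum>l\<in>I. indicator (P l) x)) * cmod (?h x - ?k x)"
        by simp
      also have "\<dots> = indicator A x * cmod (?h x - ?k x) + (\<Sum>l\<in>I. indicator (P l) x * cmod (?h x - ?k x))"
        by (simp add: distrib_right sum_distrib_right)
      also have "indicator A x * cmod (?h x - ?k x) \<le> indicator A x * cmod (?h x) + indicator A x * cmod (?k x)"
        using norm_triangle_ineq4[of "?h x" "?k x"] by (simp add: indicator_def)
      finally show "cmod (?h x - ?k x) \<le> indicator A x * cmod (?h x) + indicator A x * cmod (?k x)
        + (\<Sum>l\<in>I. indicator (P l) x * cmod (?h x - ?k x))" by simp
    qed
    also have "\<dots> = (\<integral>x. indicator A x * cmod (?h x) \<partial>N) + (\<integral>x. indicator A x * cmod (?k x) \<partial>N)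
        + (\<Sum>l\<in>I. (\<integral>x. indicator (P l) x * cmod (?h x - ?k x) \<partial>N))"
      using iA iP by (simp add: Bochner_Integration.integral_sum Bochner_Integration.integrable_sum)
    also have "(\<Sum>l\<in>I. (\<integral>x. indicator (P l) x * cmod (?h x - ?k x) \<partial>N))
        \<le> (\<Sum>l\<in>I. osc (P l) ?h + osc (P l) ?k + 2 * \<eta>)"
    proof (rule sum_mono)
      fix l assume l: "l \<in> I"
      have "q (a i l) = q (a j l)" using fun_cong[OF ij(3), of l] l by (simp add: \<kappa>_def)
      then have "dist (a i l) (a j l) < 2 * \<eta>"
        using q[OF a_bound[OF l, of i]] q[OF a_bound[OF l, of j]]
          dist_triangle2[of "a i l" "a j l" "q (a i l)"] by (simp add: dist_commute)
      then show "(\<integral>x. indicator (P l) x * cmod (?h x - ?k x) \<partial>N) \<le> osc (P l) ?h + osc (P l) ?k + 2 * \<eta>"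
        using L1_dist_le_osc[OF P[OF l] h k] by (simp add: a_def dist_norm)
    qed
    also have "\<dots> = W i + W j + real (card I) * (2 * \<eta>)" by (simp add: W_def sum.distrib)
    finally show "(\<integral>x. cmod (?h x - ?k x) \<partial>N) < r"
      using rest[of i] rest[of j] ij(1,2) \<eta>(2) r unfolding A_def[symmetric] R_def \<epsilon>_def by simp
  qed (fact density)
qed

text \<open>The order of choices is decisive: \<tau> comes from uniform integrability, then
  \<open>K\<close> from \<tau>, then \<delta> from \<open>r / 128\<close>. A finite net of
  \<open>K\<close> with radius \<open>\<delta> / 2\<close> finally gives cells of small mean
  distance.\<close>

lemma mean_equicontinuous_orbit_classification:
  fixes M :: "'a::metric_space measure"
  assumes "measure_preserving M T" and sets: "sets M = sets borel" and f: "integrable M f"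
    and meq: "mean_equicontinuous M T f" and r: "0 < r"
  obtains \<kappa> :: "nat \<Rightarrow> nat \<Rightarrow> complex" and R :: "nat set" and n0 where "finite (range \<kappa>)"
    "\<And>i j. i \<in> R \<Longrightarrow> j \<in> R \<Longrightarrow> \<kappa> i = \<kappa> j \<Longrightarrow> (\<integral>x. cmod (f ((T ^^ i) x) - f ((T ^^ j) x)) \<partial>M) < r"
    "\<And>n. n0 \<le> n \<Longrightarrow> 8 * card ({..<n} - R) \<le> n"
proof -
  interpret measure_preserving M T by fact
  have "0 < r / 8" using r by simp
  from orbit_uniformly_small[OF f this] obtain \<tau> where \<tau>: "0 < \<tau>"
    "\<And>A i. A \<in> sets M \<Longrightarrow> measure M A < \<tau> \<Longrightarrow> (\<integral>x. indicator A x * cmod (f ((T ^^ i) x)) \<partial>M) < r / 8" by metis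
  from meq[unfolded mean_equicontinuous_def mean_dist_def[symmetric], rule_format, OF \<tau>(1)]
  obtain K where K: "compact K" "1 - \<tau> < measure M K"
    "\<forall>\<epsilon>>0. \<exists>\<delta>>0. \<forall>x\<in>K. \<forall>y\<in>K. dist x y < \<delta> \<longrightarrow> mean_dist f x y < ereal \<epsilon>"
    by (elim exE conjE)
  have "0 < r / 128" using r by simp
  from K(3)[rule_format, OF this] obtain \<delta> where \<delta>: "0 < \<delta>"
    "\<And>x y. x \<in> K \<Longrightarrow> y \<in> K \<Longrightarrow> dist x y < \<delta> \<Longrightarrow> mean_dist f x y < ereal (r / 128)" by blast
  have "0 < \<delta> / 2" using \<delta> by simp
  from K(1)[unfolded compact_eq_totally_bounded, THEN conjunct2, rule_format, OF this]
  obtain k where k: "finite k" "K \<subseteq> (\<Union>x\<in>k. ball x (\<delta> / 2))" by (elim exE conjE)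
  then obtain e and m :: nat where e: "k = e ` {i. i < m}" by (auto simp: finite_conv_nat_seg_image)
  \<comment> \<open>\<open>disjointed\<close> acts on sequences, so the finite cover is continued by
    empty sets.\<close>
  define D where "D i = (if i < m then K \<inter> ball (e i) (\<delta> / 2) else {})" for i
  define P where "P = disjointed D"
  have Ks [measurable]: "K \<in> sets M" using compact_imp_closed[OF K(1)] by (simp add: sets)
  have Ds: "D i \<in> sets M" for i
    unfolding D_def using Ks by (auto simp: sets)
  have P_sub: "P i \<subseteq> D i" for i unfolding P_def by (rule disjointed_subset)
  have P_cover: "(\<Union>i<m. P i) = K"
  proof -
    have "i < m" if "x \<in> P i" for x i
      using P_sub[of i] that by (auto simp: D_def split: if_splits)
    then have "(\<Union>i<m. P i) = (\<Union>i. P i)" by blast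
    also have "\<dots> = (\<Union>i. D i)" unfolding P_def by (rule UN_disjointed_eq)
    also have "\<dots> = K" using k(2) unfolding e D_def by (auto split: if_splits)
    finally show ?thesis .
  qed
  show thesis
  proof (rule orbit_classification[OF f r, of "{..<m}" P])
    show "P i \<in> sets M" for i
      unfolding P_def using sets.range_disjointed_sets[of D M] Ds by auto
    show "disjoint_family_on P {..<m}"
      unfolding P_def using disjoint_family_disjointed[of D] by (rule disjoint_family_on_mono[rotated]) simp
    show "mean_dist f x y < ereal (r / 128)" if xy: "i \<in> {..<m}" "x \<in> P i" "y \<in> P i" for i x y
    proof -
      have "x \<in> K" "y \<in> K" "dist (e i) x < \<delta> / 2" "dist (e i) y < \<delta> / 2"
        using xy subsetD[OF P_sub[of i]] by (auto simp: D_def split: if_splits)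
      then show ?thesis using dist_triangle2[of x y "e i"] by (intro \<delta>(2)) (auto simp: dist_commute)
    qed
    show "(\<integral>x. indicator (space M - (\<Union>k<m. P k)) x * cmod (f ((T ^^ i) x)) \<partial>M) < r / 8" for i
      unfolding P_cover using K(2) by (intro \<tau>(2)) (auto simp: prob_compl)
  qed (use that in blast)+
qed


section \<open>Integer iterates and the two-sided orbit\<close>

lemma (in measure_preserving) measure_preserving_inv:
  assumes bij: "bij S" and inv [measurable]: "inv S \<in> measurable N N"
  shows "measure_preserving N (inv S)"
proof (rule measure_preserving.intro)
  have "distr N N (inv S) = distr (distr N N S) N (inv S)" by (simp add: distr_S)
  also have "\<dots> = distr N N (inv S \<circ> S)" by (rule distr_distr) measurable
  also have "\<dots> = N" using bij by (simp add: bij_is_inj id_def)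
  finally show "distr N N (inv S) = N" .
qed (rule prob_N inv)+

lemma (in measure_preserving)
  assumes bij: "bij S" and inv: "inv S \<in> measurable N N"
  shows int_iterate_measurable: "int_iterate S n \<in> measurable N N"
    and distr_int_iterate: "distr N N (int_iterate S n) = N"
proof -
  interpret J: measure_preserving N "inv S" by (rule measure_preserving_inv[OF bij inv])
  show "int_iterate S n \<in> measurable N N" "distr N N (int_iterate S n) = N"
    unfolding int_iterate_def by (simp_all add: distr_iter J.distr_iter)
qed

lemma int_iterate_of_nat: "int_iterate T (int k) = T ^^ k"
  by (simp add: int_iterate_def)

lemma int_iterate_Suc:
  assumes "bij T"
  shows "int_iterate T (n + 1) x = T (int_iterate T n x)"
proof (cases "0 \<le> n")
  case True
  then show ?thesis by (simp add: int_iterate_def nat_add_distrib)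
next
  case False
  define k where "k = nat (- n - 1)"
  with False have n: "n = - int (Suc k)" by simp
  have "int_iterate T (n + 1) x = (inv T ^^ k) x"
    unfolding n by (cases k) (auto simp: int_iterate_def nat_add_distrib)
  moreover have "int_iterate T n x = inv T ((inv T ^^ k) x)"
    unfolding n by (simp add: int_iterate_def nat_add_distrib)
  ultimately show ?thesis using assms by (simp add: bij_is_surj surj_f_inv_f)
qed

text \<open>Upwards the induction is \<open>int_iterate_Suc\<close>; downwards \<open>T\<close> is
  applied to both sides and cancelled by injectivity.\<close>

lemma int_iterate_add:
  assumes "bij T"
  shows "int_iterate T (m + n) x = int_iterate T m (int_iterate T n x)"
proof (induction m rule: int_induct[where k = 0])
  case base
  show ?case by (simp add: int_iterate_def)
next
  case (step1 m)
  then show ?case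
    using int_iterate_Suc[OF assms, of "m + n" x] int_iterate_Suc[OF assms, of m]
    by (simp add: algebra_simps)
next
  case (step2 m)
  have "T (int_iterate T (m - 1 + n) x) = int_iterate T (m + n) x"
    using int_iterate_Suc[OF assms, of "m - 1 + n" x] by (simp add: algebra_simps)
  also have "\<dots> = T (int_iterate T (m - 1) (int_iterate T n x))"
    using int_iterate_Suc[OF assms, of "m - 1" "int_iterate T n x"] step2 by simp
  finally show ?case using assms by (simp add: bij_is_inj inj_eq)
qed

text \<open>On a long initial segment, few times lie outside \<open>R\<close> and few are carried
  outside \<open>R\<close> by adding \<open>k\<close>; together these exceptions cannot fill the
  segment.\<close>

lemma dense_set_shift:
  fixes R :: "nat set" and n0 k :: nat
  assumes dense: "\<And>n. n0 \<le> n \<Longrightarrow> 8 * card ({..<n} - R) \<le> n"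
  shows "\<exists>i. i \<in> R \<and> i + k \<in> R"
proof (rule ccontr)
  assume none: "\<not> ?thesis"
  \<comment> \<open>\<open>L\<close> exceeds both \<open>n0\<close> and \<open>k\<close>, so the two
    exceptional sets together have at most \<open>(2 * L + k) / 8 < L\<close> elements.\<close>
  define L where "L = n0 + k + 1"
  have "{..<L} \<subseteq> ({..<L} - R) \<union> {i \<in> {..<L}. i + k \<notin> R}" using none by auto
  then have "card {..<L} \<le> card (({..<L} - R) \<union> {i \<in> {..<L}. i + k \<notin> R})" by (intro card_mono) auto
  also have "\<dots> \<le> card ({..<L} - R) + card {i \<in> {..<L}. i + k \<notin> R}" by (rule card_Un_le)
  also have "card {i \<in> {..<L}. i + k \<notin> R} \<le> card ({..<L + k} - R)"
    by (rule card_inj_on_le[of "\<lambda>i. i + k"]) (auto simp: inj_on_def)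
  finally have "L \<le> card ({..<L} - R) + card ({..<L + k} - R)" by simp
  with dense[of L] dense[of "L + k"] show False by (simp add: L_def)
qed

text \<open>For each \<open>n\<close> some pair of times \<open>i, i + n\<close> lies in the dense set \<open>R\<close>; the pair of classes of these
  two times determines \<open>f \<circ> int_iterate T n\<close> up to a small error, by invariance of the measure.\<close>

theorem orbit_totally_bounded_if_mean_equicontinuous:
  fixes M :: "'a::metric_space measure"
  assumes "measure_preserving M T" and sets: "sets M = sets borel" and f: "integrable M f"
    and bij: "bij T" and inv: "inv T \<in> measurable M M"
    and meq: "mean_equicontinuous M T f" and r: "0 < r"
  obtains J where "finite J"
    "\<And>n. \<exists>j\<in>J. (\<integral>x. cmod (f (int_iterate T n x) - f (int_iterate T j x)) \<partial>M) < r"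
proof -
  interpret measure_preserving M T by fact
  let ?U = "int_iterate T"
  let ?\<rho> = "\<lambda>m n. (\<integral>x. cmod (f (?U m x) - f (?U n x)) \<partial>M)"
  have [measurable]: "f \<in> borel_measurable M" using f by auto
  have [measurable]: "?U n \<in> measurable M M" for n by (rule int_iterate_measurable[OF bij inv])
  have fi: "integrable M (\<lambda>x. f (?U n x))" for n
    by (rule integrable_distr[of "?U n" M M]) (simp_all add: distr_int_iterate[OF bij inv] f)
  have shift: "?\<rho> (m + k) (n + k) = ?\<rho> m n" for m n k
  proof -
    have "?\<rho> (m + k) (n + k) = (\<integral>x. cmod (f (?U m (?U k x)) - f (?U n (?U k x))) \<partial>M)"
      by (simp add: int_iterate_add[OF bij])
    also have "\<dots> = (\<integral>x. cmod (f (?U m x) - f (?U n x)) \<partial>distr M M (?U k))"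
      by (rule integral_distr[symmetric]) measurable
    also have "\<dots> = ?\<rho> m n" by (simp add: distr_int_iterate[OF bij inv])
    finally show ?thesis .
  qed
  have triangle: "?\<rho> l n \<le> ?\<rho> l m + ?\<rho> m n" for l m n
  proof -
    have "?\<rho> l n \<le> (\<integral>x. cmod (f (?U l x) - f (?U m x)) + cmod (f (?U m x) - f (?U n x)) \<partial>M)"
    proof (rule integral_mono)
      show "cmod (f (?U l x) - f (?U n x)) \<le> cmod (f (?U l x) - f (?U m x)) + cmod (f (?U m x) - f (?U n x))" for x
        using norm_triangle_ineq[of "f (?U l x) - f (?U m x)" "f (?U m x) - f (?U n x)"] by simp
    qed (use fi in auto)
    then show ?thesis using fi by simp
  qed
  have "0 < r / 2" using r by simp
  obtain \<kappa> :: "nat \<Rightarrow> nat \<Rightarrow> complex" and R n0 where \<kappa>: "finite (range \<kappa>)"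
    "\<And>i j. i \<in> R \<Longrightarrow> j \<in> R \<Longrightarrow> \<kappa> i = \<kappa> j \<Longrightarrow>
      (\<integral>x. cmod (f ((T ^^ i) x) - f ((T ^^ j) x)) \<partial>M) < r / 2"
    and dense: "\<And>n. n0 \<le> n \<Longrightarrow> 8 * card ({..<n} - R) \<le> n"
    by (rule mean_equicontinuous_orbit_classification[OF assms(1) sets f meq \<open>0 < r / 2\<close>]) blast
  have close: "?\<rho> (int i) (int j) < r / 2" if "i \<in> R" "j \<in> R" "\<kappa> i = \<kappa> j" for i j
    using \<kappa>(2)[OF that] by (simp only: int_iterate_of_nat)
  \<comment> \<open>\<open>R\<close> contains only natural numbers, so a negative \<open>n\<close>
    is the difference of such a pair in the opposite order.\<close>
  have "\<exists>i l. i \<in> R \<and> l \<in> R \<and> int l = n + int i" for n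
  proof (cases "0 \<le> n")
    case True
    obtain i where "i \<in> R" "i + nat n \<in> R" using dense_set_shift[OF dense] by blast
    with True show ?thesis by (intro exI[of _ i] exI[of _ "i + nat n"]) simp
  next
    case False
    obtain l where "l \<in> R" "l + nat (- n) \<in> R" using dense_set_shift[OF dense] by blast
    with False show ?thesis by (intro exI[of _ "l + nat (- n)"] exI[of _ l]) simp
  qed
  then obtain a b where ab: "\<And>n. a n \<in> R" "\<And>n. b n \<in> R" "\<And>n. int (b n) = n + int (a n)" by metis
  define p where "p n = (\<kappa> (a n), \<kappa> (b n))" for n
  have same: "?\<rho> n j < r" if "p n = p j" for n j
  proof -
    have eq: "\<kappa> (a n) = \<kappa> (a j)" "\<kappa> (b n) = \<kappa> (b j)" using that by (simp_all add: p_def)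
    \<comment> \<open>After translation by \<open>a j\<close> the time \<open>j\<close> becomes
      \<open>b j\<close>. The intermediate time \<open>n + a n = b n\<close> is compared with
      \<open>n + a j\<close> through the first classes and with \<open>b j\<close> through the
      second.\<close>
    have "?\<rho> n j = ?\<rho> (n + int (a j)) (j + int (a j))" by (rule shift[symmetric])
    also have "\<dots> \<le> ?\<rho> (n + int (a j)) (n + int (a n)) + ?\<rho> (n + int (a n)) (j + int (a j))"
      by (rule triangle)
    also have "?\<rho> (n + int (a j)) (n + int (a n)) = ?\<rho> (int (a j)) (int (a n))"
      using shift[of "int (a j)" n "int (a n)"] by (simp add: add.commute)
    also have "\<dots> < r / 2" by (rule close[OF ab(1) ab(1) eq(1)[symmetric]])
    also have "?\<rho> (n + int (a n)) (j + int (a j)) < r / 2"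
      using close[OF ab(2) ab(2) eq(2)] by (simp only: ab(3))
    finally show ?thesis by simp
  qed
  show thesis
  proof (rule that)
    have "range p \<subseteq> range \<kappa> \<times> range \<kappa>" by (auto simp: p_def)
    then have "finite (range p)" by (rule finite_subset) (simp add: \<kappa>(1))
    \<comment> \<open>One representative time is kept for each of the finitely many pairs of
      classes.\<close>
    then show "finite (inv_into UNIV p ` range p)" by simp
    show "\<exists>j\<in>inv_into UNIV p ` range p. ?\<rho> n j < r" for n
    proof (rule bexI)
      show "?\<rho> n (inv_into UNIV p (p n)) < r"
        by (rule same) (simp add: f_inv_into_f)
    qed simp
  qed
qed

theorem theorem5p2:
  fixes T :: "'a::metric_space \<Rightarrow> 'a" and M :: "'a measure" and f :: "'a \<Rightarrow> complex"
  assumes "compact (UNIV :: 'a set)"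
    and "homeomorphism UNIV UNIV T (inv T)"
    and "prob_space M" and "sets M = sets borel"
    and "distr M M T = M"
    and "f \<in> L2_fun M"
  shows "almost_periodic M T f \<longleftrightarrow> mean_equicontinuous M T f"
proof -
  let ?U = "int_iterate T"
  have T: "T \<in> borel \<rightarrow>\<^sub>M borel" "inv T \<in> borel \<rightarrow>\<^sub>M borel"
    using assms(2) by (auto simp: homeomorphism_def intro: borel_measurable_continuous_onI)
  have inv: "inv T \<in> measurable M M" and T_meas: "T \<in> measurable M M"
    using T by (simp_all add: measurable_cong_sets[OF assms(4) assms(4)])
  have measure_preserving: "measure_preserving M T" by (rule measure_preserving.intro) (fact assms T_meas)+
  interpret measure_preserving M T by (fact measure_preserving)
  have bij: "bij T"
    using assms(2) by (intro o_bij[of "inv T"]) (auto simp: homeomorphism_def)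
  have f: "integrable M f" and [measurable]: "f \<in> borel_measurable M"
    using L2_fun_integrable[OF assms(6)] by auto
  have U [measurable]: "?U n \<in> measurable M M" for n by (rule int_iterate_measurable[OF bij inv])
  have distr_fU: "distr M borel (\<lambda>x. f (?U n x)) = distr M borel f" for n
    using distr_distr[of f M borel "?U n" M] by (simp add: distr_int_iterate[OF bij inv] comp_def)
  have L2: "(\<lambda>x. f (?U n x)) \<in> L2_fun M" for n
    using assms(6) integrable_distr[OF U, of n "\<lambda>x. (cmod (f x))\<^sup>2"]
    by (simp add: L2_fun_def distr_int_iterate[OF bij inv])
  have ap: "almost_periodic M T f \<longleftrightarrow>
    (\<forall>r>0. \<exists>J. finite J \<and> (\<forall>n. \<exists>j\<in>J. L2_norm M (\<lambda>x. f (?U n x) - f (?U j x)) < r))"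
    unfolding almost_periodic_def comp_def by (rule compactin_L2_closure_iff[OF assms(3) L2])
  show ?thesis
  proof
    assume "almost_periodic M T f"
    note tb = this[unfolded ap, rule_format]
    show "mean_equicontinuous M T f"
    proof (rule mean_equicontinuous_if_orbit_totally_bounded[OF measure_preserving assms(1,4) f])
      fix r :: real assume "0 < r"
      from tb[OF this] obtain J where J: "finite J"
        "\<forall>n. \<exists>j\<in>J. L2_norm M (\<lambda>x. f (?U n x) - f (?U j x)) < r" by (elim exE conjE)
      \<comment> \<open>The centres may be iterates at negative times; only forward times are tested
        against them.\<close>
      let ?G = "(\<lambda>j x. f (?U j x)) ` J"
      have "\<exists>h\<in>?G. (\<integral>x. cmod (f ((T ^^ i) x) - h x) \<partial>M) < r" for i
      proof -
        from J(2) obtain j where j: "j \<in> J" "L2_norm M (\<lambda>x. f (?U (int i) x) - f (?U j x)) < r"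
          by blast
        with integral_cmod_le_L2_norm[OF L2_fun_diff[OF L2[of "int i"] L2[of j]]]
        show ?thesis by (intro bexI[of _ "\<lambda>x. f (?U j x)"]) (auto simp: int_iterate_of_nat)
      qed
      moreover have "finite ?G" using J(1) by simp
      moreover have "\<forall>h\<in>?G. integrable M h" using L2_fun_integrable[OF L2] by auto
      ultimately show "\<exists>G. finite G \<and> (\<forall>h\<in>G. integrable M h) \<and>
          (\<forall>i. \<exists>h\<in>G. (\<integral>x. cmod (f ((T ^^ i) x) - h x) \<partial>M) < r)"
        by (intro exI[of _ ?G] conjI allI)
    qed
  next
    assume meq: "mean_equicontinuous M T f"
    show "almost_periodic M T f"
      unfolding ap
    proof (intro allI impI)
      fix r :: real assume "0 < r"
      \<comment> \<open>All iterates of \<open>f\<close> have its distribution, so a single L1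
        threshold \<open>d\<close> serves every pair of times and brings the L1 net back to
        L2.\<close>
      obtain d where d: "0 < d"
        "\<And>u v. u \<in> borel_measurable M \<Longrightarrow> v \<in> borel_measurable M \<Longrightarrow>
          distr M borel u = distr M borel f \<Longrightarrow> distr M borel v = distr M borel f \<Longrightarrow>
          (\<integral>x. cmod (u x - v x) \<partial>M) < d \<Longrightarrow> L2_norm M (\<lambda>x. u x - v x) < r"
        by (rule L2_norm_small_if_L1_small[OF assms(6) \<open>0 < r\<close>]) blast
      obtain J where J: "finite J"
        "\<And>n. \<exists>j\<in>J. (\<integral>x. cmod (f (?U n x) - f (?U j x)) \<partial>M) < d"
        by (rule orbit_totally_bounded_if_mean_equicontinuous[OF measure_preserving assms(4) f bij inv meq d(1)]) blast
      have "\<exists>j\<in>J. L2_norm M (\<lambda>x. f (?U n x) - f (?U j x)) < r" for n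
      proof -
        from J(2)[of n] obtain j where j: "j \<in> J" "(\<integral>x. cmod (f (?U n x) - f (?U j x)) \<partial>M) < d"
          by (elim bexE)
        have "L2_norm M (\<lambda>x. f (?U n x) - f (?U j x)) < r"
          by (rule d(2)[OF _ _ distr_fU distr_fU j(2)]) measurable
        with j(1) show ?thesis by (rule bexI[rotated])
      qed
      with J(1) show "\<exists>J. finite J \<and> (\<forall>n. \<exists>j\<in>J. L2_norm M (\<lambda>x. f (?U n x) - f (?U j x)) < r)"
        by (intro exI[of _ J] conjI allI)
    qed
  qed
qed

end
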